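(* Let $K$ be a field and let $I\subseteq K[x,y,z]=K[\mathbb{P}^2]$ be the homogeneous ideal of a finite set of points of $\mathbb{P}^2$. (a) If $I$ is the ideal of an almost collinear subscheme of $n+1$ points with $n\geq 3$, then $I^{(nt)}=(I^{(n)})^t$ for every integer $t\geq 1$; moreover, $n$ is the least positive integer $e$ such that $I^{(et)}=(I^{(e)})^t$ for all $t\geq 1$. (b) If $I$ is the ideal of a nearly-complete intersection of $2n+1$ points, then $I^{(2st)}=(I^{(2s)})^t$ for all integers $s,t\geq 1$.
   Context: $K$ is a field of arbitrary characteristic and $K[\mathbb{P}^2]=K[x,y,z]$. The ideal of a finite set of distinct points $q_1,\dots,q_s\in\mathbb{P}^2$ is $I=\bigcap_i I(q_i)$, where $I(q_i)$ is the ideal generated by all forms vanishing at $q_i$; its $m$-th symbolic power is $I^{(m)}=\bigcap_i I(q_i)^m$. An almost collinear subscheme of $n+1$ points ($n\geq 2$) is a set of distinct points $p_0,p_1,\dots,p_n\in\mathbb{P}^2$ such that $p_1,\dots,p_n$ lie on a line $L$ and $p_0\notin L$. A nearly-complete intersection of $2n+1$ points ($n\geq 1$) is a set of distinct points $p_0,p_1,\dots,p_{2n}\in\mathbb{P}^2$ for which there are two distinct lines $L_1,L_2$ such that $p_0$ is the point $L_1\cap L_2$, $p_1,\dots,p_n\in L_1\setminus L_2$ and $p_{n+1},\dots,p_{2n}\in L_2\setminus L_1$. *)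

theory Defs
  imports
    "HOL-Library.Poly_Mapping"
    "HOL-Library.Numeral_Type"
    "HOL-Analysis.Finite_Cartesian_Product"
    "HOL-Algebra.Ideal_Product"
    "HOL-Algebra.Algebraic_Closure_Type"
begin

text \<open>
  A monomial is a finitely supported exponent function on the three-element type \<open>3\<close>,
  whose elements 0, 1, 2 index the variables x, y, z. The field K is the type \<open>'a::field\<close>.
\<close>
type_synonym 'a poly3 = "(3 \<Rightarrow>\<^sub>0 nat) \<Rightarrow>\<^sub>0 'a"

definition eval_monom :: "(3 \<Rightarrow>\<^sub>0 nat) \<Rightarrow> ('a::comm_ring_1)^3 \<Rightarrow> 'a" where
  "eval_monom m v = (\<Prod>i\<in>UNIV. v $ i ^ Poly_Mapping.lookup m i)"

definition eval3 :: "'a::comm_ring_1 poly3 \<Rightarrow> 'a^3 \<Rightarrow> 'a" where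
  "eval3 f v = (\<Sum>m\<in>Poly_Mapping.keys f. Poly_Mapping.lookup f m * eval_monom m v)"

text \<open>The zero polynomial is a form of every degree.\<close>
definition form :: "nat \<Rightarrow> 'a::zero poly3 \<Rightarrow> bool" where
  "form d f \<longleftrightarrow> (\<forall>m\<in>Poly_Mapping.keys f. (\<Sum>i\<in>UNIV. Poly_Mapping.lookup m i) = d)"

definition proportional :: "('a::field)^3 \<Rightarrow> 'a^3 \<Rightarrow> bool" where
  "proportional v w \<longleftrightarrow> v \<noteq> 0 \<and> (\<exists>c. c \<noteq> 0 \<and> w = c *s v)"

lemma proportional_part_equivp: "part_equivp (proportional :: ('a::field)^3 \<Rightarrow> _)"
proof (rule part_equivpI)
  have "proportional (1 :: 'a^3) 1"
    unfolding proportional_def by (auto intro!: exI[of _ 1] simp: vec_eq_iff)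
  then show "\<exists>x :: 'a^3. proportional x x" by blast
  show "symp (proportional :: 'a^3 \<Rightarrow> _)"
  proof (rule sympI)
    fix v w :: "'a^3" assume "proportional v w"
    then obtain c where c: "v \<noteq> 0" "c \<noteq> 0" "w = c *s v"
      unfolding proportional_def by blast
    have "v = inverse c *s w"
      using c by (simp add: vec_eq_iff)
    moreover have "w \<noteq> 0"
      using c by (auto simp: vec_eq_iff)
    ultimately show "proportional w v"
      using c unfolding proportional_def by (metis nonzero_imp_inverse_nonzero)
  qed
  show "transp (proportional :: 'a^3 \<Rightarrow> _)"
  proof (rule transpI)
    fix u v w :: "'a^3" assume "proportional u v" "proportional v w"
    then obtain c d where "u \<noteq> 0" "c \<noteq> 0" "v = c *s u" "d \<noteq> 0" "w = d *s v"
      unfolding proportional_def by blast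
    then show "proportional u w"
      unfolding proportional_def
      by (auto intro!: exI[of _ "d * c"] simp: vec_eq_iff mult.assoc)
  qed
qed

text \<open>The projective plane over \<open>'a\<close>: nonzero vectors up to nonzero scalars.\<close>
quotient_type (overloaded) 'a proj_plane = "('a::field)^3" / partial: proportional
  by (rule proportional_part_equivp)

definition vanishes_at :: "'a::field poly3 \<Rightarrow> 'a proj_plane \<Rightarrow> bool" where
  "vanishes_at f q \<longleftrightarrow> (\<forall>v. v \<noteq> 0 \<and> abs_proj_plane v = q \<longrightarrow> eval3 f v = 0)"

definition is_line :: "'a::field proj_plane set \<Rightarrow> bool" where
  "is_line L \<longleftrightarrow> (\<exists>l. form 1 l \<and> l \<noteq> 0 \<and> L = {q. vanishes_at l q})"

abbreviation poly3_ring :: "'a::field poly3 ring" where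
  "poly3_ring \<equiv> ring_of_type_algebra"

definition point_ideal :: "'a::field proj_plane \<Rightarrow> 'a poly3 set" where
  "point_ideal q = Idl\<^bsub>poly3_ring\<^esub> {f. (\<exists>d. form d f) \<and> vanishes_at f q}"

definition ideal_of_points :: "'a::field proj_plane set \<Rightarrow> 'a poly3 set" where
  "ideal_of_points Z = (\<Inter>q\<in>Z. point_ideal q)"

definition ideal_power :: "'a::field poly3 set \<Rightarrow> nat \<Rightarrow> 'a poly3 set" where
  "ideal_power I m = I [^]\<^bsub>ideals_set poly3_ring\<^esub> m"

definition zero_locus :: "'a::field poly3 set \<Rightarrow> 'a proj_plane set" where
  "zero_locus I = {q. \<forall>f\<in>I. \<forall>d. form d f \<longrightarrow> vanishes_at f q}"

text \<open>
  Intended only for ideals of finite sets of points. Such an ideal determines its set of points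
  as its zero locus, so this is the intersection of the powers \<open>I(q\<^sub>i)\<^sup>m\<close>; see
  \<open>symbolic_power_ideal_of_points\<close> below.
\<close>
definition symbolic_power :: "'a::field poly3 set \<Rightarrow> nat \<Rightarrow> 'a poly3 set" where
  "symbolic_power I m = (\<Inter>q\<in>zero_locus I. ideal_power (point_ideal q) m)"

definition almost_collinear :: "nat \<Rightarrow> 'a::field proj_plane set \<Rightarrow> bool" where
  "almost_collinear n Z \<longleftrightarrow> n \<ge> 2 \<and>
     (\<exists>p L. inj_on p {0..n} \<and> Z = p ` {0..n} \<and> is_line L \<and>
            p ` {1..n} \<subseteq> L \<and> p 0 \<notin> L)"

definition nearly_complete_intersection :: "nat \<Rightarrow> 'a::field proj_plane set \<Rightarrow> bool" where
  "nearly_complete_intersection n Z \<longleftrightarrow> n \<ge> 1 \<and>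
     (\<exists>p L1 L2. inj_on p {0..2*n} \<and> Z = p ` {0..2*n} \<and>
            is_line L1 \<and> is_line L2 \<and> L1 \<noteq> L2 \<and> L1 \<inter> L2 = {p 0} \<and>
            p ` {1..n} \<subseteq> L1 - L2 \<and> p ` {n+1..2*n} \<subseteq> L2 - L1)"

lemma eval3_superset:
  assumes "finite A" "Poly_Mapping.keys f \<subseteq> A"
  shows "eval3 f v = (\<Sum>m\<in>A. Poly_Mapping.lookup f m * eval_monom m v)"
  unfolding eval3_def
  by (rule sum.mono_neutral_left) (use assms in \<open>auto simp: in_keys_iff\<close>)

lemma eval3_zero [simp]: "eval3 0 v = 0"
  by (simp add: eval3_def)

lemma eval3_add: "eval3 (f + g) v = eval3 f v + eval3 g v"
proof -
  let ?A = "Poly_Mapping.keys f \<union> Poly_Mapping.keys g"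
  have "Poly_Mapping.keys (f + g) \<subseteq> ?A" by (rule Poly_Mapping.keys_add)
  then show ?thesis
    by (simp add: eval3_superset[of ?A] lookup_add distrib_right sum.distrib)
qed

lemma eval3_single: "eval3 (Poly_Mapping.single m c) v = c * eval_monom m v"
  by (cases "c = 0") (simp_all add: eval3_def)

lemma eval3_one: "eval3 1 v = (1::'a::comm_ring_1)"
  using eval3_single[of 0 "1::'a" v] by (simp add: eval_monom_def)

lemma eval_monom_add: "eval_monom (m + n) v = eval_monom m v * eval_monom n v"
  by (simp add: eval_monom_def lookup_add power_add prod.distrib)

lemma poly3_induct [case_names zero add]:
  fixes f :: "'a::comm_ring_1 poly3"
  assumes "P 0" and "\<And>m c f. P f \<Longrightarrow> P (Poly_Mapping.single m c + f)"
  shows "P f"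
proof (induction f rule: update_induct)
  case const then show ?case by (rule assms(1))
next
  case (update f a b)
  have "Poly_Mapping.update a b f = Poly_Mapping.single a b + f"
    using update(1) by (intro poly_mapping_eqI)
      (auto simp: lookup_update lookup_add lookup_single when_def in_keys_iff)
  then show ?case using assms(2)[OF update(3)] by simp
qed

lemma eval3_mult: "eval3 (f * g) v = eval3 f v * eval3 g v"
proof (induction f rule: poly3_induct)
  case zero then show ?case by simp
next
  case (add m c f)
  have "eval3 (Poly_Mapping.single m c * g) v = c * eval_monom m v * eval3 g v"
    by (induction g rule: poly3_induct)
      (simp_all add: eval3_add eval3_single distrib_left mult_single eval_monom_add mult_ac)
  then show ?case
    using add by (simp add: distrib_right eval3_add eval3_single)
qed

lemma poly3_ring_simps:
  "carrier poly3_ring = UNIV"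
  "monoid.mult poly3_ring = (*)"
  "ring.add poly3_ring = (+)"
  "ring.zero poly3_ring = 0"
  "monoid.one poly3_ring = 1"
  by (auto simp: ring_of_type_algebra_def fun_eq_iff)

lemma cring_poly3_ring: "cring (poly3_ring :: 'a::field poly3 ring)"
  by (rule cring_from_type_algebra)

lemma form_mult:
  fixes f :: "'a::field poly3"
  assumes "form d f" "form e g"
  shows "form (d + e) (f * g)"
  unfolding form_def
proof
  fix m assume "m \<in> Poly_Mapping.keys (f * g)"
  then obtain a b where "a \<in> Poly_Mapping.keys f" "b \<in> Poly_Mapping.keys g" "m = a + b"
    using keys_mult[of f g] by blast
  then show "(\<Sum>i\<in>UNIV. Poly_Mapping.lookup m i) = d + e"
    using assms by (auto simp: form_def lookup_add sum.distrib)
qed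

lemma form_one: "form 0 (1 :: 'a::field poly3)"
  by (simp add: form_def)

lemma eval_monom_scale:
  fixes v :: "('a::field)^3"
  shows "eval_monom m (c *s v) = c ^ (\<Sum>i\<in>UNIV. Poly_Mapping.lookup m i) * eval_monom m v"
  by (simp add: eval_monom_def power_mult_distrib prod.distrib power_sum)

lemma eval3_scale:
  fixes v :: "('a::field)^3"
  assumes "form d f"
  shows "eval3 f (c *s v) = c ^ d * eval3 f v"
  using assms
  by (simp add: eval3_def form_def eval_monom_scale sum_distrib_left mult_ac)

lemma proportional_refl: "proportional v v \<longleftrightarrow> v \<noteq> 0"
  unfolding proportional_def by (metis vector_smult_lid zero_neq_one)

lemma abs_proj_plane_eq_iff:
  assumes "v \<noteq> 0" "w \<noteq> 0"
  shows "abs_proj_plane v = abs_proj_plane w \<longleftrightarrow> proportional v w"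
  using Quotient3_rel[OF Quotient3_proj_plane, of v w] assms by (simp add: proportional_refl)

lemma proj_plane_cases:
  obtains v where "v \<noteq> 0" "q = abs_proj_plane v"
proof -
  have "abs_proj_plane (rep_proj_plane q) = q"
    by (rule Quotient3_abs_rep[OF Quotient3_proj_plane])
  moreover have "rep_proj_plane q \<noteq> 0"
    using Quotient3_rep_reflp[OF Quotient3_proj_plane, of q] by (simp add: proportional_refl)
  ultimately show ?thesis using that by metis
qed

lemma form_vanishes_at:
  assumes "form d f" "v \<noteq> 0"
  shows "vanishes_at f (abs_proj_plane v) \<longleftrightarrow> eval3 f v = 0"
proof
  assume "eval3 f v = 0"
  show "vanishes_at f (abs_proj_plane v)"
    unfolding vanishes_at_def
  proof (intro allI impI)
    fix w assume w: "w \<noteq> 0 \<and> abs_proj_plane w = abs_proj_plane v"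
    then have "proportional v w" using abs_proj_plane_eq_iff[of v w] assms by simp
    then show "eval3 f w = 0"
      using \<open>eval3 f v = 0\<close> eval3_scale[OF assms(1)] by (auto simp: proportional_def)
  qed
qed (use assms in \<open>auto simp: vanishes_at_def\<close>)

lemma point_ideal_vanishes:
  assumes "f \<in> point_ideal q"
  shows "vanishes_at f q"
proof -
  interpret cring "poly3_ring :: 'a poly3 ring" by (rule cring_poly3_ring)
  have "ideal {f. vanishes_at f q} poly3_ring"
  proof (rule idealI)
    show "ring (poly3_ring :: 'a poly3 ring)" by (rule ring_axioms)
    have "eval3 (- g) v = - eval3 g v" for g :: "'a poly3" and v
      using eval3_add[of g "- g" v] by (simp add: eq_neg_iff_add_eq_0 add.commute)
    moreover have "\<ominus>\<^bsub>poly3_ring\<^esub> g = - g" for g :: "'a poly3"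
      by (rule minus_equality) (auto simp: poly3_ring_simps)
    ultimately show "subgroup {f. vanishes_at f q} (add_monoid poly3_ring)"
      unfolding a_inv_def
      by (intro subgroup.intro)
        (simp_all only: monoid.simps partial_object.simps poly3_ring_simps(1,3,4),
         simp_all add: vanishes_at_def eval3_add)
  qed (auto simp: poly3_ring_simps vanishes_at_def eval3_mult)
  then have "point_ideal q \<subseteq> {f. vanishes_at f q}"
    unfolding point_ideal_def by (rule genideal_minimal) auto
  then show ?thesis using assms by blast
qed

lemma form_in_point_ideal:
  assumes "form d f" "vanishes_at f q"
  shows "f \<in> point_ideal q"
proof -
  interpret cring "poly3_ring :: 'a poly3 ring" by (rule cring_poly3_ring)
  show ?thesis
    unfolding point_ideal_def using genideal_self[of "{f. (\<exists>d. form d f) \<and> vanishes_at f q}"] assms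
    by (auto simp: poly3_ring_simps)
qed

lemma separate_points:
  fixes p q :: "'a::field proj_plane"
  assumes "p \<noteq> q"
  shows "\<exists>l. form 1 l \<and> vanishes_at l p \<and> \<not> vanishes_at l q"
proof -
  obtain v where v: "v \<noteq> 0" "p = abs_proj_plane v" by (rule proj_plane_cases)
  obtain w where w: "w \<noteq> 0" "q = abs_proj_plane w" by (rule proj_plane_cases)
  define L :: "3 \<Rightarrow> 3 \<Rightarrow> 'a poly3" where "L i j = Poly_Mapping.single (Poly_Mapping.single i 1) (v $ j)
      + Poly_Mapping.single (Poly_Mapping.single j 1) (- (v $ i))" for i j
  have form: "form 1 (L i j)" for i j
  proof -
    have sub: "Poly_Mapping.keys (L i j) \<subseteq> {Poly_Mapping.single i 1, Poly_Mapping.single j 1}"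
      unfolding L_def by (rule order.trans[OF Poly_Mapping.keys_add]) auto
    have "(\<Sum>k\<in>UNIV. Poly_Mapping.lookup (Poly_Mapping.single i (1::nat)) k) = 1" for i :: 3
      by (simp add: lookup_single when_def)
    then show ?thesis using sub by (auto simp: form_def)
  qed
  have mon: "eval_monom (Poly_Mapping.single i 1) u = u $ i" for i and u :: "'a^3"
  proof -
    have "eval_monom (Poly_Mapping.single i 1) u = (\<Prod>k\<in>UNIV. if k = i then u $ k else 1)"
      unfolding eval_monom_def by (rule prod.cong) (auto simp: lookup_single when_def)
    then show ?thesis by simp
  qed
  have ev: "eval3 (L i j) u = v $ j * u $ i - v $ i * u $ j" for i j and u :: "'a^3"
    using mon unfolding L_def by (simp add: eval3_add eval3_single)
  have "\<exists>i j. eval3 (L i j) w \<noteq> 0"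
  proof (rule ccontr)
    assume *: "\<not> ?thesis"
    obtain k where k: "v $ k \<noteq> 0" using v(1) by (auto simp: vec_eq_iff)
    have "v $ k * w $ i = v $ i * w $ k" for i
      using * ev[of i k w] by simp
    then have eq: "w = (w $ k / v $ k) *s v"
      using k by (auto simp: vec_eq_iff field_simps)
    then have "w $ k / v $ k \<noteq> 0"
      using w(1) by (metis vector_smult_lzero)
    then have "proportional v w"
      using eq v(1) unfolding proportional_def by blast
    then show False using assms v w abs_proj_plane_eq_iff[of v w] by simp
  qed
  then obtain i j where "eval3 (L i j) w \<noteq> 0" by blast
  then show ?thesis
    using form_vanishes_at[OF form v(1)] form_vanishes_at[OF form w(1)] v(2) w(2) form ev[of i j v]
    by (intro exI[of _ "L i j"]) (simp add: mult.commute)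
qed

lemma separate_point_from_finite:
  fixes q :: "'a::field proj_plane"
  assumes "finite Z" "q \<notin> Z"
  shows "\<exists>d f. form d f \<and> (\<forall>p\<in>Z. vanishes_at f p) \<and> \<not> vanishes_at f q"
  using assms
proof (induction Z rule: finite_induct)
  case empty
  obtain w where "w \<noteq> 0" "q = abs_proj_plane w" by (rule proj_plane_cases)
  then show ?case
    using form_one by (intro exI[of _ 0] exI[of _ 1]) (auto simp: vanishes_at_def eval3_one)
next
  case (insert p Z)
  then obtain d f where f: "form d f" "\<forall>p\<in>Z. vanishes_at f p" "\<not> vanishes_at f q" by auto
  obtain l where l: "form 1 l" "vanishes_at l p" "\<not> vanishes_at l q"
    using separate_points[of p q] insert by auto
  obtain w where w: "w \<noteq> 0" "q = abs_proj_plane w" by (rule proj_plane_cases)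
  have fl: "form (d + 1) (f * l)" using form_mult f(1) l(1) by blast
  have "\<not> vanishes_at (f * l) q"
    using f l w form_vanishes_at[OF fl w(1)] form_vanishes_at[OF f(1) w(1)]
      form_vanishes_at[OF l(1) w(1)] by (simp add: eval3_mult)
  moreover have "\<forall>p\<in>insert p Z. vanishes_at (f * l) p"
    using f(2) l(2) by (auto simp: vanishes_at_def eval3_mult)
  ultimately show ?case using fl by blast
qed

lemma zero_locus_ideal_of_points:
  assumes "finite Z"
  shows "zero_locus (ideal_of_points Z) = Z"
proof (intro equalityI subsetI)
  fix q assume q: "q \<in> zero_locus (ideal_of_points Z)"
  show "q \<in> Z"
  proof (rule ccontr)
    assume "q \<notin> Z"
    then obtain d f where "form d f" "\<forall>p\<in>Z. vanishes_at f p" "\<not> vanishes_at f q"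
      using separate_point_from_finite[OF assms] by blast
    then show False
      using q by (auto simp: zero_locus_def ideal_of_points_def intro: form_in_point_ideal)
  qed
qed (auto simp: zero_locus_def ideal_of_points_def intro: point_ideal_vanishes)

lemma symbolic_power_ideal_of_points:
  assumes "finite Z"
  shows "symbolic_power (ideal_of_points Z) m = (\<Inter>q\<in>Z. ideal_power (point_ideal q) m)"
  by (simp add: symbolic_power_def zero_locus_ideal_of_points[OF assms])

end

theory Submission
  imports Defs "HOL-Analysis.Cartesian_Space"
begin

text \<open>
  Both configurations consist of a point \<open>q\<^sub>0\<close> with ideal \<open>P\<close> and of further points whose ideals are
  cut out by a complete intersection \<open>(b, c)\<close>: the \<open>m\<close>-th powers of their ideals meet in
  \<open>(b, c)\<^sup>m\<close>. Here \<open>b\<close> does not vanish at \<open>q\<^sub>0\<close>, while \<open>c\<close> is a product of \<open>r\<close> lines through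
  \<open>q\<^sub>0\<close>. For almost collinear points, \<open>b\<close> is the line that carries the points, \<open>c\<close> is the product of
  the lines that join them to \<open>q\<^sub>0\<close>, and \<open>r = n\<close>. For a nearly-complete intersection, \<open>c = x y\<close> is
  the product of the two lines, \<open>b\<close> is a form of degree \<open>n\<close> that restricts on each line to the form
  cutting out its \<open>n\<close> points, and \<open>r = 2\<close>.

  Since \<open>c\<close> has order exactly \<open>r\<close> at \<open>q\<^sub>0\<close>, even modulo \<open>b\<close>, the symbolic power
  \<open>I\<^sup>(\<^sup>m\<^sup>) = (b, c)\<^sup>m \<inter> P\<^sup>m\<close> is generated by the products \<open>b\<^sup>j c\<^sup>i h\<close> with \<open>i + j = m\<close> and
  \<open>h \<in> P\<^sup>m\<^sup>-\<^sup>r\<^sup>i\<close>, where powers with negative exponent are the whole ring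
  (\<open>pow2_Int_filtration\<close>). For \<open>m = r s t\<close> the exponents of such a generator can be shared out
  among \<open>t\<close> factors that lie in \<open>I\<^sup>(\<^sup>r\<^sup>s\<^sup>)\<close> (\<open>generator_in_power\<close>), so
  \<open>I\<^sup>(\<^sup>r\<^sup>s\<^sup>t\<^sup>) = (I\<^sup>(\<^sup>r\<^sup>s\<^sup>))\<^sup>t\<close>. The case \<open>s = 1\<close>, \<open>r = n\<close> is the statement on almost collinear
  points, and \<open>r = 2\<close> is the statement on nearly-complete intersections.

  For almost collinear points and \<open>1 \<le> e < n\<close>, give \<open>b\<close> the weight \<open>n - e\<close> and the elements of
  \<open>P\<close> the weight one. All generators of \<open>I\<^sup>(\<^sup>e\<^sup>)\<close> have weight at least \<open>(n - e) e + e\<close>, but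
  \<open>b\<^sup>e\<^sup>n\<^sup>-\<^sup>e c\<^sup>e \<in> I\<^sup>(\<^sup>e\<^sup>n\<^sup>)\<close> has weight less than \<open>n\<close> times that, so that
  \<open>I\<^sup>(\<^sup>e\<^sup>n\<^sup>) \<noteq> (I\<^sup>(\<^sup>e\<^sup>))\<^sup>n\<close> (\<open>symb_power_neq\<close>).

  What is needed about powers of ideals holds for regular sequences \<open>x, y\<close> of length two in any
  domain, through the recursion \<open>(x, y)\<^sup>k\<^sup>+\<^sup>1 = (y\<^sup>k\<^sup>+\<^sup>1) + x (x, y)\<^sup>k\<close>. It applies here because
  nonzero linear forms are prime, and because the ideal of a point is a prime ideal generated by any
  two linear forms whose only common zero in the plane is that point.
\<close>

section \<open>Powers of ideals generated by two elements of a domain\<close>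

text \<open>Ideals of a commutative ring whose carrier is the whole type.\<close>
definition ring_ideal :: "'r::comm_ring_1 set \<Rightarrow> bool" where
  "ring_ideal J \<longleftrightarrow> 0 \<in> J \<and> (\<forall>f\<in>J. \<forall>g\<in>J. f + g \<in> J) \<and> (\<forall>f\<in>J. \<forall>r. r * f \<in> J)"

lemma ring_idealI:
  assumes "0 \<in> J" "\<And>f g. f \<in> J \<Longrightarrow> g \<in> J \<Longrightarrow> f + g \<in> J" "\<And>f r. f \<in> J \<Longrightarrow> r * f \<in> J"
  shows "ring_ideal J"
  using assms by (simp add: ring_ideal_def)

lemma ring_idealD:
  assumes "ring_ideal J"
  shows "0 \<in> J" "f \<in> J \<Longrightarrow> g \<in> J \<Longrightarrow> f + g \<in> J" "f \<in> J \<Longrightarrow> r * f \<in> J" "f \<in> J \<Longrightarrow> f * r \<in> J"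
  using assms by (auto simp: ring_ideal_def mult.commute)

lemma ring_ideal_diff:
  assumes "ring_ideal J" "f \<in> J" "g \<in> J"
  shows "f - g \<in> J"
  using ring_idealD(2)[OF assms(1,2), of "- 1 * g"] ring_idealD(3)[OF assms(1,3), of "-1"] by simp

lemma ring_ideal_INT:
  assumes "\<And>i. i \<in> A \<Longrightarrow> ring_ideal (J i)"
  shows "ring_ideal (\<Inter>i\<in>A. J i)"
  using assms by (auto simp: ring_ideal_def)

text \<open>Multiplication by \<open>c\<close> is injective modulo \<open>J\<close>.\<close>
definition regular_mod :: "'r::comm_ring_1 \<Rightarrow> 'r set \<Rightarrow> bool" where
  "regular_mod c J \<longleftrightarrow> (\<forall>u. c * u \<in> J \<longrightarrow> u \<in> J)"

lemma regular_modD: "regular_mod c J \<Longrightarrow> c * u \<in> J \<Longrightarrow> u \<in> J"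
  by (simp add: regular_mod_def)

lemma regular_mod_one: "regular_mod 1 J"
  by (simp add: regular_mod_def)

lemma regular_mod_mult: "regular_mod c J \<Longrightarrow> regular_mod d J \<Longrightarrow> regular_mod (c * d) J"
  unfolding regular_mod_def mult.assoc by blast

lemma regular_mod_power: "regular_mod c J \<Longrightarrow> regular_mod (c ^ k) J"
  by (induction k) (simp_all add: regular_mod_one regular_mod_mult)

lemma regular_mod_prod:
  "(\<And>i. i \<in> A \<Longrightarrow> regular_mod (c i) J) \<Longrightarrow> regular_mod (\<Prod>i\<in>A. c i) J"
  by (induction A rule: infinite_finite_induct) (simp_all add: regular_mod_one regular_mod_mult)

text \<open>The ideal \<open>(x, y)\<close>.\<close>
definition gen2 :: "'r::comm_ring_1 \<Rightarrow> 'r \<Rightarrow> 'r set" where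
  "gen2 x y = {x * f + y * g | f g. True}"

lemma gen2I: "h = x * f + y * g \<Longrightarrow> h \<in> gen2 x y"
  by (auto simp: gen2_def)

lemma gen2E:
  assumes "h \<in> gen2 x y"
  obtains f g where "h = x * f + y * g"
  using assms by (auto simp: gen2_def)

lemma gen2_mem: "x \<in> gen2 x y" "y \<in> gen2 x y"
  by (auto intro: gen2I[of _ _ 1 _ 0] gen2I[of _ _ 0 _ 1])

lemma gen2_minimal:
  assumes "ring_ideal J" "x \<in> J" "y \<in> J"
  shows "gen2 x y \<subseteq> J"
  by (auto simp: gen2_def intro!: ring_idealD[OF assms(1)] assms)

lemma ring_ideal_gen2: "ring_ideal (gen2 x y)"
proof (rule ring_idealI)
  show "0 \<in> gen2 x y" by (rule gen2I[of _ _ 0 _ 0]) simp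
next
  fix f g assume "f \<in> gen2 x y" "g \<in> gen2 x y"
  then obtain a b c d where "f = x * a + y * b" "g = x * c + y * d" by (auto elim!: gen2E)
  then show "f + g \<in> gen2 x y" by (intro gen2I[of _ _ "a + c" _ "b + d"]) (simp add: algebra_simps)
next
  fix f r assume "f \<in> gen2 x y"
  then obtain a b where "f = x * a + y * b" by (auto elim!: gen2E)
  then show "r * f \<in> gen2 x y" by (intro gen2I[of _ _ "r * a" _ "r * b"]) (simp add: algebra_simps)
qed

lemma gen2_commute: "gen2 x y = gen2 y x"
  by (auto simp: gen2_def) (metis add.commute)+

text \<open>
  The power \<open>(x, y)\<^sup>k\<close>, through the recursion \<open>(x, y)\<^sup>k\<^sup>+\<^sup>1 = (y\<^sup>k\<^sup>+\<^sup>1) + x (x, y)\<^sup>k\<close>, which lets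
  every argument about these powers peel off one power of \<open>y\<close> and divide by \<open>x\<close>.
\<close>
fun pow2 :: "'r::comm_ring_1 \<Rightarrow> 'r \<Rightarrow> nat \<Rightarrow> 'r set" where
  "pow2 x y 0 = UNIV"
| "pow2 x y (Suc k) = {y ^ Suc k * u + x * g | u g. g \<in> pow2 x y k}"

lemma pow2_SucI: "g \<in> pow2 x y k \<Longrightarrow> h = y ^ Suc k * u + x * g \<Longrightarrow> h \<in> pow2 x y (Suc k)"
  by auto

lemma pow2_SucE:
  assumes "h \<in> pow2 x y (Suc k)"
  obtains u g where "g \<in> pow2 x y k" "h = y ^ Suc k * u + x * g"
  using assms by auto

lemma ring_ideal_pow2: "ring_ideal (pow2 x y k)"
proof (induction k)
  case 0 then show ?case by (simp add: ring_ideal_def)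
next
  case (Suc k)
  show ?case
  proof (rule ring_idealI)
    show "0 \<in> pow2 x y (Suc k)" by (rule pow2_SucI[OF ring_idealD(1)[OF Suc], where u = 0]) simp
  next
    fix f g assume "f \<in> pow2 x y (Suc k)" "g \<in> pow2 x y (Suc k)"
    then obtain a b c d where "b \<in> pow2 x y k" "f = y ^ Suc k * a + x * b"
      "d \<in> pow2 x y k" "g = y ^ Suc k * c + x * d" by (elim pow2_SucE)
    then show "f + g \<in> pow2 x y (Suc k)"
      by (intro pow2_SucI[OF ring_idealD(2)[OF Suc, of b d], where u = "a + c"])
        (simp_all add: algebra_simps)
  next
    fix f r assume "f \<in> pow2 x y (Suc k)"
    then obtain a b where "b \<in> pow2 x y k" "f = y ^ Suc k * a + x * b" by (elim pow2_SucE)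
    then show "r * f \<in> pow2 x y (Suc k)"
      by (intro pow2_SucI[OF ring_idealD(3)[OF Suc, of b r], where u = "r * a"])
        (simp_all add: algebra_simps)
  qed
qed

lemma pow2_y: "y ^ k * u \<in> pow2 x y k"
proof (cases k)
  case (Suc n)
  show ?thesis
    unfolding Suc by (rule pow2_SucI[OF ring_idealD(1)[OF ring_ideal_pow2], where u = u]) simp
qed simp

lemma pow2_mult_x: "g \<in> pow2 x y k \<Longrightarrow> x * g \<in> pow2 x y (Suc k)"
  by (rule pow2_SucI[of g _ _ _ _ 0]) simp_all

lemma pow2_mult_y: "g \<in> pow2 x y k \<Longrightarrow> y * g \<in> pow2 x y (Suc k)"
proof (induction k arbitrary: g)
  case 0 show ?case by (rule pow2_SucI[of 0 _ _ _ _ g]) simp_all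
next
  case (Suc k)
  obtain u h where h: "h \<in> pow2 x y k" "g = y ^ Suc k * u + x * h" using Suc.prems by (rule pow2_SucE)
  show ?case
    by (rule pow2_SucI[OF Suc.IH[OF h(1)], where u = u]) (simp add: h(2) algebra_simps)
qed

text \<open>A regular sequence of length two, without the condition that \<open>(x, y)\<close> be proper.\<close>
definition regular_pair :: "'r::comm_ring_1 \<Rightarrow> 'r \<Rightarrow> bool" where
  "regular_pair x y \<longleftrightarrow> x \<noteq> 0 \<and> (\<forall>u. x dvd y * u \<longrightarrow> x dvd u)"

lemma regular_pair_power_dvd:
  assumes "regular_pair x y" "x dvd y ^ k * u"
  shows "x dvd u"
  using assms(2)
proof (induction k arbitrary: u)
  case 0 then show ?case by simp
next
  case (Suc k)
  from Suc.prems have "x dvd y * (y ^ k * u)" by (simp add: mult.assoc)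
  then have "x dvd y ^ k * u" using assms(1) unfolding regular_pair_def by blast
  then show ?case by (rule Suc.IH)
qed

lemma regular_pair_prime:
  assumes "prime_elem x" "\<not> x dvd y"
  shows "regular_pair x y"
  unfolding regular_pair_def
  using assms(2) assms(1)[unfolded prime_elem_def] prime_elem_dvd_multD[OF assms(1)] by blast

lemma regular_mod_gen2_power:
  fixes x y c :: "'r::idom"
  assumes xy: "regular_pair x y" and c: "regular_mod c (gen2 x y)"
  shows "regular_mod c (gen2 x (y ^ m))"
proof (induction m)
  case 0
  have "u \<in> gen2 x (y ^ 0)" for u by (rule gen2I[of _ _ 0 _ u]) simp
  then show ?case by (simp add: regular_mod_def)
next
  case (Suc m)
  show ?case
    unfolding regular_mod_def
  proof (intro allI impI)
    fix u assume "c * u \<in> gen2 x (y ^ Suc m)"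
    then obtain p q where pq: "c * u = x * p + y ^ Suc m * q" by (rule gen2E)
    then have "c * u \<in> gen2 x y" by (intro gen2I[of _ _ p _ "y ^ m * q"]) (simp add: algebra_simps)
    then have "u \<in> gen2 x y" by (rule regular_modD[OF c])
    then obtain r s where rs: "u = x * r + y * s" by (rule gen2E)
    have "y * (c * s - y ^ m * q) = x * (p - c * r)" using pq rs by (simp add: algebra_simps)
    then have "x dvd c * s - y ^ m * q" using xy unfolding regular_pair_def by (metis dvd_triv_left)
    then obtain d where "c * s - y ^ m * q = x * d" by (elim dvdE)
    then have "c * s \<in> gen2 x (y ^ m)" by (intro gen2I[of _ _ d _ q]) (simp add: algebra_simps)
    then obtain e f where "s = x * e + y ^ m * f" using regular_modD[OF Suc] by (blast elim: gen2E)
    then show "u \<in> gen2 x (y ^ Suc m)"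
      using rs by (intro gen2I[of _ _ "r + y * e" _ f]) (simp add: algebra_simps)
  qed
qed

lemma regular_mod_pow2:
  fixes x y c :: "'r::idom"
  assumes xy: "regular_pair x y" and c: "regular_mod c (gen2 x y)"
  shows "regular_mod c (pow2 x y m)"
proof (induction m)
  case 0 show ?case by (simp add: regular_mod_def)
next
  case (Suc m)
  show ?case
    unfolding regular_mod_def
  proof (intro allI impI)
    fix u assume "c * u \<in> pow2 x y (Suc m)"
    then obtain v g where g: "g \<in> pow2 x y m" "c * u = y ^ Suc m * v + x * g" by (rule pow2_SucE)
    have "c * u \<in> gen2 x (y ^ Suc m)" using g(2) by (intro gen2I[of _ _ g _ v]) simp
    then obtain p q where pq: "u = x * p + y ^ Suc m * q"
      using regular_modD[OF regular_mod_gen2_power[OF xy c]] by (blast elim: gen2E)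
    have eq: "y ^ Suc m * (v - c * q) = x * (c * p - g)" using g(2) pq by (simp add: algebra_simps)
    then have "x dvd v - c * q" using regular_pair_power_dvd[OF xy] by (metis dvd_triv_left)
    then obtain d where d: "v - c * q = x * d" by (elim dvdE)
    have "x * (c * p - g) = x * (y ^ Suc m * d)"
      using eq unfolding d by (simp add: algebra_simps)
    then have "c * p - g = y ^ Suc m * d" using xy unfolding regular_pair_def by simp
    then have "c * p = g + y ^ m * (y * d)" by (simp add: algebra_simps)
    then have "c * p \<in> pow2 x y m" using g(1) by (auto intro: ring_idealD(2)[OF ring_ideal_pow2] pow2_y)
    then have "p \<in> pow2 x y m" by (rule regular_modD[OF Suc])
    then show "u \<in> pow2 x y (Suc m)" using pq by (intro pow2_SucI[of p x y m u q]) simp_all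
  qed
qed

lemma pow2_cancel_x:
  fixes x y w :: "'r::idom"
  assumes xy: "regular_pair x y" and w: "x * w \<in> pow2 x y (Suc m)"
  shows "w \<in> pow2 x y m"
proof -
  obtain u g where g: "g \<in> pow2 x y m" "x * w = y ^ Suc m * u + x * g" using w by (rule pow2_SucE)
  have "y ^ Suc m * u = x * (w - g)" using g(2) by (simp add: algebra_simps)
  then have "x dvd u" using regular_pair_power_dvd[OF xy] by (metis dvd_triv_left)
  then obtain d where "u = x * d" by (elim dvdE)
  then have "x * w = x * (g + y ^ m * (y * d))" using g(2) by (simp add: algebra_simps)
  then have "w = g + y ^ m * (y * d)" using xy unfolding regular_pair_def by simp
  then show ?thesis using g(1) by (auto intro: ring_idealD(2)[OF ring_ideal_pow2] pow2_y)
qed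

text \<open>
  Cancellation of \<open>x\<close> modulo \<open>b\<close>. Since \<open>b\<close> is regular modulo \<open>(x, y\<^sup>m\<^sup>+\<^sup>1)\<close>, the multiple
  \<open>b d\<close> can be replaced by one with \<open>d\<close> divisible by \<open>x\<close>.
\<close>
lemma pow2_cancel_x_mod:
  fixes x y b w d :: "'r::idom"
  assumes xy: "regular_pair x y" and b: "regular_mod b (gen2 x y)"
    and w: "x * w - b * d \<in> pow2 x y (Suc m)"
  shows "\<exists>d'. w - b * d' \<in> pow2 x y m"
proof -
  obtain u g where g: "g \<in> pow2 x y m" "x * w - b * d = y ^ Suc m * u + x * g"
    using w by (rule pow2_SucE)
  have "b * d \<in> gen2 x (y ^ Suc m)"
    using g(2) by (intro gen2I[of _ _ "w - g" _ "- u"]) (simp add: algebra_simps)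
  then obtain p q where pq: "d = x * p + y ^ Suc m * q"
    using regular_modD[OF regular_mod_gen2_power[OF xy b]] by (blast elim: gen2E)
  have "x * (w - b * p) = y ^ Suc m * (b * q + u) + x * g"
    using g(2) pq by (simp add: algebra_simps)
  then have "x * (w - b * p) \<in> pow2 x y (Suc m)" using g(1) pow2_SucI by blast
  then show ?thesis using pow2_cancel_x[OF xy] by blast
qed

text \<open>
  The step from one point to several on the same line \<open>x\<close>. Writing \<open>f = a\<^sup>m u + x g\<close>, the factor
  \<open>u\<close> is divisible by \<open>b\<^sup>m\<close> up to a multiple of \<open>x\<close>, and the cofactor of \<open>x\<close> then satisfies the same
  hypotheses with \<open>m - 1\<close>.
\<close>
lemma pow2_Int:
  fixes x a b :: "'r::idom"
  assumes xa: "regular_pair x a" and xb: "regular_pair x b" and a: "regular_mod a (gen2 x b)"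
  shows "pow2 x a m \<inter> pow2 x b m \<subseteq> pow2 x (a * b) m"
proof (induction m)
  case 0 show ?case by simp
next
  case (Suc m)
  show ?case
  proof
    fix f assume f: "f \<in> pow2 x a (Suc m) \<inter> pow2 x b (Suc m)"
    obtain u g where g: "g \<in> pow2 x a m" "f = a ^ Suc m * u + x * g"
      using f by (blast elim: pow2_SucE)
    obtain v h where h: "h \<in> pow2 x b m" "f = b ^ Suc m * v + x * h"
      using f by (blast elim: pow2_SucE)
    have "a ^ Suc m * u \<in> gen2 x (b ^ Suc m)"
      using g(2) h(2) by (intro gen2I[of _ _ "h - g" _ v]) (simp add: algebra_simps)
    then have "u \<in> gen2 x (b ^ Suc m)"
      by (rule regular_modD[OF regular_mod_power[OF regular_mod_gen2_power[OF xb a]]])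
    then obtain p q where pq: "u = x * p + b ^ Suc m * q" by (rule gen2E)
    define G where "G = a ^ m * (a * p) + g"
    have fG: "f = (a * b) ^ Suc m * q + x * G"
      using g(2) pq by (simp add: G_def algebra_simps)
    have "G \<in> pow2 x a m"
      unfolding G_def using g(1) by (intro ring_idealD(2)[OF ring_ideal_pow2] pow2_y)
    moreover have "G \<in> pow2 x b m"
    proof (rule pow2_cancel_x[OF xb])
      have "x * G = f - b ^ Suc m * (a ^ Suc m * q)" using fG by (simp add: algebra_simps)
      then show "x * G \<in> pow2 x b (Suc m)"
        using f by (auto simp del: power_Suc pow2.simps
            intro: ring_ideal_diff[OF ring_ideal_pow2] pow2_y)
    qed
    ultimately have "G \<in> pow2 x (a * b) m" using Suc by blast
    then show "f \<in> pow2 x (a * b) (Suc m)" using fG pow2_SucI by blast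
  qed
qed

text \<open>
  If \<open>P\<^sub>m\<close> is a filtration in which multiplication by \<open>c\<close> raises the level by exactly \<open>r\<close> modulo
  \<open>b\<close>, then \<open>(b, c)\<^sup>k \<inter> P\<^sub>m\<close> is generated additively by the evident elements \<open>b\<^sup>j c\<^sup>i h\<close>.
\<close>
lemma pow2_Int_filtration:
  fixes b c :: "'r::idom" and P :: "nat \<Rightarrow> 'r set"
  assumes P: "\<And>m. ring_ideal (P m)"
    and b: "\<And>m. regular_mod b (P m)"
    and c: "\<And>i m h. h \<in> P (m - r * i) \<Longrightarrow> c ^ i * h \<in> P m"
    and cancel: "\<And>i m u d. c ^ i * u - b * d \<in> P m \<Longrightarrow> \<exists>d'. u - b * d' \<in> P (m - r * i)"
    and f: "f \<in> pow2 b c k" "f \<in> P m"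
    and T: "\<And>g h. g \<in> T \<Longrightarrow> h \<in> T \<Longrightarrow> g + h \<in> T"
      "\<And>i j h. i + j = k \<Longrightarrow> h \<in> P (m - r * i) \<Longrightarrow> b ^ j * c ^ i * h \<in> T"
  shows "f \<in> T"
  using f T
proof (induction k arbitrary: f T)
  case 0
  have "b ^ 0 * c ^ 0 * f \<in> T" by (rule "0.prems"(4)) (use "0.prems"(2) in simp_all)
  then show ?case by simp
next
  case (Suc k)
  obtain u g where g: "g \<in> pow2 b c k" "f = c ^ Suc k * u + b * g"
    using Suc.prems(1) by (rule pow2_SucE)
  have "c ^ Suc k * u - b * (- g) \<in> P m" using g(2) Suc.prems(2) by (simp add: algebra_simps)
  then obtain d where d: "u - b * d \<in> P (m - r * Suc k)" using cancel by blast
  define h where "h = u - b * d"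
  define G where "G = c ^ k * (c * d) + g"
  have fG: "f = c ^ Suc k * h + b * G"
    using g(2) by (simp add: G_def h_def algebra_simps)
  have "b ^ 0 * c ^ Suc k * h \<in> T" by (rule Suc.prems(4)) (use d in \<open>simp_all add: h_def\<close>)
  then have hT: "c ^ Suc k * h \<in> T" by simp
  have "b * G = f - c ^ Suc k * h" using fG by (simp add: algebra_simps)
  also have "\<dots> \<in> P m"
    using Suc.prems(2) c[of h m "Suc k"] d ring_ideal_diff[OF P] unfolding h_def by blast
  finally have GP: "G \<in> P m" by (rule regular_modD[OF b])
  have Gp: "G \<in> pow2 b c k"
    unfolding G_def using g(1) by (intro ring_idealD(2)[OF ring_ideal_pow2] pow2_y)
  have "G \<in> {g. b * g \<in> T}"
  proof (rule Suc.IH[OF Gp GP])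
    fix i j h assume "i + j = k" "h \<in> P (m - r * i)"
    then have "b ^ Suc j * c ^ i * h \<in> T" by (intro Suc.prems(4)) simp_all
    then show "b ^ j * c ^ i * h \<in> {g. b * g \<in> T}" by (simp add: mult.assoc)
  next
    fix g h assume "g \<in> {g. b * g \<in> T}" "h \<in> {g. b * g \<in> T}"
    then have "b * g + b * h \<in> T" by (intro Suc.prems(3)) simp_all
    then show "g + h \<in> {g. b * g \<in> T}" by (simp add: distrib_left)
  qed
  then have "c ^ Suc k * h + b * G \<in> T" by (intro Suc.prems(3)[OF hT]) simp
  then show ?case by (simp only: fG)
qed

section \<open>Powers of ideals in the polynomial ring\<close>

lemma ring_ideal_iff: "ring_ideal J \<longleftrightarrow> ideal J (poly3_ring :: 'a::field poly3 ring)"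
proof
  interpret R: cring "poly3_ring :: 'a poly3 ring" by (rule cring_poly3_ring)
  have neg: "\<ominus>\<^bsub>poly3_ring\<^esub> g = - g" for g :: "'a poly3"
    by (rule R.minus_equality) (auto simp: poly3_ring_simps)
  assume J: "ring_ideal J"
  show "ideal J poly3_ring"
  proof (rule idealI)
    show "ring (poly3_ring :: 'a poly3 ring)" by (rule R.ring_axioms)
    have m: "- g \<in> J" if "g \<in> J" for g using ring_idealD(3)[OF J that, of "- 1"] by simp
    show "subgroup J (add_monoid poly3_ring)"
      using neg unfolding a_inv_def
      by (intro subgroup.intro)
        (simp_all only: monoid.simps partial_object.simps poly3_ring_simps(1,3,4),
         simp_all add: ring_idealD[OF J] m)
  qed (simp_all only: poly3_ring_simps ring_idealD[OF J])
next
  assume "ideal J (poly3_ring :: 'a poly3 ring)"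
  then interpret ideal J "poly3_ring :: 'a poly3 ring" .
  show "ring_ideal J"
    using additive_subgroup.zero_closed[OF additive_subgroup_axioms]
      additive_subgroup.a_closed[OF additive_subgroup_axioms] I_l_closed
    by (intro ring_idealI) (auto simp: poly3_ring_simps)
qed

lemma ring_ideal_point_ideal: "ring_ideal (point_ideal q)"
proof -
  interpret cring "poly3_ring :: 'a::field poly3 ring" by (rule cring_poly3_ring)
  show ?thesis
    unfolding ring_ideal_iff point_ideal_def by (rule genideal_ideal) (simp add: poly3_ring_simps)
qed

lemma point_ideal_minimal:
  assumes "ring_ideal J" "\<And>d f. form d f \<Longrightarrow> vanishes_at f q \<Longrightarrow> f \<in> J"
  shows "point_ideal q \<subseteq> J"
proof -
  interpret cring "poly3_ring :: 'a::field poly3 ring" by (rule cring_poly3_ring)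
  show ?thesis
    unfolding point_ideal_def using assms by (intro genideal_minimal) (auto simp: ring_ideal_iff)
qed

lemma ideal_power_0 [simp]: "ideal_power J 0 = UNIV"
  by (simp add: ideal_power_def nat_pow_def ideals_set_def poly3_ring_simps)

lemma ideal_power_Suc: "ideal_power J (Suc m) = ideal_prod poly3_ring (ideal_power J m) J"
  by (simp add: ideal_power_def nat_pow_def ideals_set_def)

lemma ideal_power_mult:
  assumes "f \<in> ideal_power J m" "g \<in> J"
  shows "f * g \<in> ideal_power J (Suc m)"
  using ideal_prod.prod[OF assms, of poly3_ring]
  unfolding ideal_power_Suc poly3_ring_simps .

lemma ideal_power_Suc_induct [consumes 1, case_names mult add]:
  assumes "f \<in> ideal_power J (Suc m)"
    and "\<And>g h. g \<in> ideal_power J m \<Longrightarrow> h \<in> J \<Longrightarrow> P (g * h)"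
    and "\<And>g h. P g \<Longrightarrow> P h \<Longrightarrow> P (g + h)"
  shows "P f"
  using assms(1) unfolding ideal_power_Suc
proof (induction rule: ideal_prod.induct)
  case (prod i j) then show ?case using assms(2) by (simp add: poly3_ring_simps)
next
  case (sum s1 s2) then show ?case using assms(3) by (simp add: poly3_ring_simps)
qed

lemma ring_ideal_ideal_power:
  assumes J: "ring_ideal J"
  shows "ring_ideal (ideal_power J m)"
proof (induction m)
  case 0 show ?case by (simp add: ring_ideal_def)
next
  case (Suc m)
  show ?case
  proof (rule ring_idealI)
    have "0 * 0 \<in> ideal_power J (Suc m)"
      by (intro ideal_power_mult ring_idealD(1)[OF Suc] ring_idealD(1)[OF J])
    then show "0 \<in> ideal_power J (Suc m)" by simp
  next
    fix f g assume "f \<in> ideal_power J (Suc m)" "g \<in> ideal_power J (Suc m)"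
    then show "f + g \<in> ideal_power J (Suc m)"
      using ideal_prod.sum[of f poly3_ring "ideal_power J m" J g]
      unfolding ideal_power_Suc poly3_ring_simps by blast
  next
    fix f r assume "f \<in> ideal_power J (Suc m)"
    then show "r * f \<in> ideal_power J (Suc m)"
    proof (induction rule: ideal_power_Suc_induct)
      case (mult g h)
      then show ?case
        using ideal_power_mult[OF ring_idealD(3)[OF Suc], of g h r] by (simp add: mult.assoc)
    next
      case (add g h)
      then show ?case
        using ideal_prod.sum[of "r * g" poly3_ring "ideal_power J m" J "r * h"]
        unfolding ideal_power_Suc poly3_ring_simps distrib_left by blast
    qed
  qed
qed

lemma ideal_power_prod:
  assumes J: "ring_ideal J" and "f \<in> ideal_power J m" "g \<in> ideal_power J n"
  shows "f * g \<in> ideal_power J (m + n)"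
  using assms(3)
proof (induction n arbitrary: g)
  case 0
  show ?case using ring_idealD(4)[OF ring_ideal_ideal_power[OF J] assms(2)] by simp
next
  case (Suc n)
  show ?case using Suc.prems
  proof (induction rule: ideal_power_Suc_induct)
    case (mult g h)
    then show ?case using ideal_power_mult[OF Suc.IH, of g h] by (simp add: mult.assoc)
  next
    case (add g h)
    then show ?case
      using ring_idealD(2)[OF ring_ideal_ideal_power[OF J]] by (simp only: distrib_left)
  qed
qed

lemma ideal_power_pow:
  assumes "ring_ideal J" "f \<in> ideal_power J m"
  shows "f ^ i \<in> ideal_power J (m * i)"
proof (induction i)
  case (Suc i) then show ?case using ideal_power_prod[OF assms Suc] by (simp add: add.commute)
qed simp

lemma ideal_power_1:
  assumes "f \<in> J"
  shows "f \<in> ideal_power J 1"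
  using ideal_power_mult[of 1 J 0 f] assms by simp

lemma ideal_power_add_induct:
  assumes "f \<in> ideal_power J (m + n)"
    and "\<And>g h. g \<in> T \<Longrightarrow> h \<in> T \<Longrightarrow> g + h \<in> T"
    and "\<And>g h. g \<in> ideal_power J m \<Longrightarrow> h \<in> ideal_power J n \<Longrightarrow> g * h \<in> T"
  shows "f \<in> T"
  using assms
proof (induction n arbitrary: f T)
  case 0
  then have "f * 1 \<in> T" by (intro "0.prems"(3)) simp_all
  then show ?case by simp
next
  case (Suc n)
  have "f \<in> ideal_power J (Suc (m + n))" using Suc.prems(1) by simp
  then show ?case
  proof (induction rule: ideal_power_Suc_induct)
    case (mult g h)
    have "g \<in> {g. g * h \<in> T}"
    proof (rule Suc.IH[OF mult(1)])
      fix a b assume "a \<in> ideal_power J m" "b \<in> ideal_power J n"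
      then have "a * (b * h) \<in> T" by (intro Suc.prems(3) ideal_power_mult mult(2))
      then show "a * b \<in> {g. g * h \<in> T}" by (simp add: mult.assoc)
    next
      fix a b assume "a \<in> {g. g * h \<in> T}" "b \<in> {g. g * h \<in> T}"
      then have "a * h + b * h \<in> T" by (intro Suc.prems(2)) simp_all
      then show "a + b \<in> {g. g * h \<in> T}" by (simp add: distrib_right)
    qed
    then show ?case by simp
  next
    case (add g h)
    then show ?case by (rule Suc.prems(2))
  qed
qed

lemma ideal_power_antimono:
  assumes J: "ring_ideal J" and "m \<le> n"
  shows "ideal_power J n \<subseteq> ideal_power J m"
proof
  fix f assume "f \<in> ideal_power J n"
  then have "f \<in> ideal_power J (m + (n - m))" using assms(2) by simp
  then show "f \<in> ideal_power J m"
    by (rule ideal_power_add_induct)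
      (rule ring_idealD[OF ring_ideal_ideal_power[OF J]]; assumption)+
qed

text \<open>The part of \<open>(I\<^sub>1 \<inter> \<dots> \<inter> I\<^sub>s)\<^sup>t \<subseteq> I\<^sub>1\<^sup>t \<inter> \<dots> \<inter> I\<^sub>s\<^sup>t\<close> for one factor.\<close>
lemma ideal_power_power_subset:
  assumes J: "ring_ideal J" and S: "S \<subseteq> ideal_power J e"
  shows "ideal_power S t \<subseteq> ideal_power J (e * t)"
proof (induction t)
  case 0 show ?case by simp
next
  case (Suc t)
  show ?case
  proof
    fix f assume "f \<in> ideal_power S (Suc t)"
    then show "f \<in> ideal_power J (e * Suc t)"
    proof (induction rule: ideal_power_Suc_induct)
      case (mult g h)
      then have "g * h \<in> ideal_power J (e * t + e)"
        using Suc S by (intro ideal_power_prod[OF J]) auto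
      then show ?case by (simp add: add.commute)
    qed (rule ring_idealD(2)[OF ring_ideal_ideal_power[OF J]])
  qed
qed

lemma ideal_power_gen2:
  fixes x y :: "'a::field poly3"
  shows "ideal_power (gen2 x y) m = pow2 x y m"
proof (induction m)
  case 0 show ?case by simp
next
  case (Suc m)
  note J = ring_ideal_gen2[of x y]
  show ?case
  proof (intro equalityI subsetI)
    fix f assume "f \<in> ideal_power (gen2 x y) (Suc m)"
    then show "f \<in> pow2 x y (Suc m)"
    proof (induction rule: ideal_power_Suc_induct)
      case (mult g h)
      obtain a b where ab: "h = x * a + y * b" using mult(2) by (rule gen2E)
      have "g * h = x * (a * g) + y * (b * g)" unfolding ab by (simp add: algebra_simps)
      moreover have "g \<in> pow2 x y m" using mult(1) Suc by simp
      ultimately show ?case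
        using ring_idealD(2,3)[OF ring_ideal_pow2] pow2_mult_x pow2_mult_y by metis
    qed (rule ring_idealD(2)[OF ring_ideal_pow2])
  next
    fix f assume "f \<in> pow2 x y (Suc m)"
    then obtain u g where g: "g \<in> pow2 x y m" "f = y ^ Suc m * u + x * g" by (rule pow2_SucE)
    have "y \<in> ideal_power (gen2 x y) 1" by (intro ideal_power_1 gen2_mem)
    then have "y ^ Suc m * u \<in> ideal_power (gen2 x y) (Suc m)"
      using ideal_power_pow[OF J, of y 1 "Suc m"]
      by (intro ring_idealD(4)[OF ring_ideal_ideal_power[OF J]]) simp
    moreover have "g * x \<in> ideal_power (gen2 x y) (Suc m)"
      using g(1) Suc by (intro ideal_power_mult gen2_mem) simp
    ultimately show "f \<in> ideal_power (gen2 x y) (Suc m)"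
      unfolding g(2) by (metis ring_idealD(2)[OF ring_ideal_ideal_power[OF J]] mult.commute)
  qed
qed

section \<open>Linear forms and the ideal of a point\<close>

text \<open>Constants and variables as polynomials.\<close>
definition constp :: "'a::field \<Rightarrow> 'a poly3" where
  "constp c = Poly_Mapping.single 0 c"

definition varp :: "3 \<Rightarrow> 'a::field poly3" where
  "varp i = Poly_Mapping.single (Poly_Mapping.single i 1) 1"

lemma constp_0 [simp]: "constp 0 = 0" and constp_1 [simp]: "constp 1 = 1"
  by (simp_all add: constp_def)

lemma constp_add: "constp (a + b) = constp a + constp b"
  by (simp add: constp_def single_add)

lemma constp_mult: "constp (a * b) = constp a * constp b"
  by (simp add: constp_def mult_single)

lemma constp_sum: "constp (sum f A) = (\<Sum>i\<in>A. constp (f i))"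
  by (induction A rule: infinite_finite_induct) (simp_all add: constp_add)

lemma constp_prod: "constp (prod f A) = (\<Prod>i\<in>A. constp (f i))"
  by (induction A rule: infinite_finite_induct) (simp_all add: constp_mult)

lemma constp_power: "constp (a ^ k) = constp a ^ k"
  by (induction k) (simp_all add: constp_mult)

lemma varp_power: "varp i ^ k = Poly_Mapping.single (Poly_Mapping.single i k) 1"
  by (induction k) (simp_all add: varp_def mult_single single_add[symmetric] add.commute)

lemma single_eq_constp_varp:
  "Poly_Mapping.single m c = constp c * (\<Prod>i\<in>UNIV. varp i ^ Poly_Mapping.lookup m i)"
proof -
  have "(\<Prod>i\<in>A. varp i ^ Poly_Mapping.lookup m i) =
      Poly_Mapping.single (\<Sum>i\<in>A. Poly_Mapping.single i (Poly_Mapping.lookup m i)) (1::'a)"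
    if "finite A" for A
    using that by (induction A) (simp_all add: varp_power mult_single)
  moreover have "(\<Sum>i\<in>UNIV. Poly_Mapping.single i (Poly_Mapping.lookup m i)) = m"
    by (rule poly_mapping_eqI) (simp add: lookup_sum lookup_single when_def)
  ultimately show ?thesis by (simp add: constp_def mult_single)
qed

text \<open>The \<open>K\<close>-algebra endomorphism of \<open>K[x, y, z]\<close> that sends the variable \<open>i\<close> to \<open>u i\<close>.\<close>
definition subst_poly :: "(3 \<Rightarrow> 'a::field poly3) \<Rightarrow> 'a poly3 \<Rightarrow> 'a poly3" where
  "subst_poly u f = (\<Sum>m\<in>Poly_Mapping.keys f.
     constp (Poly_Mapping.lookup f m) * (\<Prod>i\<in>UNIV. u i ^ Poly_Mapping.lookup m i))"

lemma subst_poly_superset: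
  assumes "finite A" "Poly_Mapping.keys f \<subseteq> A"
  shows "subst_poly u f = (\<Sum>m\<in>A.
     constp (Poly_Mapping.lookup f m) * (\<Prod>i\<in>UNIV. u i ^ Poly_Mapping.lookup m i))"
  unfolding subst_poly_def
  by (rule sum.mono_neutral_left) (use assms in \<open>auto simp: in_keys_iff\<close>)

lemma subst_poly_0 [simp]: "subst_poly u 0 = 0"
  by (simp add: subst_poly_def)

lemma subst_poly_add: "subst_poly u (f + g) = subst_poly u f + subst_poly u g"
proof -
  let ?A = "Poly_Mapping.keys f \<union> Poly_Mapping.keys g"
  have "Poly_Mapping.keys (f + g) \<subseteq> ?A" by (rule Poly_Mapping.keys_add)
  then show ?thesis
    by (simp add: subst_poly_superset[of ?A] lookup_add constp_add distrib_right sum.distrib)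
qed

lemma subst_poly_sum: "subst_poly u (sum f A) = (\<Sum>i\<in>A. subst_poly u (f i))"
  by (induction A rule: infinite_finite_induct) (simp_all add: subst_poly_add)

lemma subst_poly_single:
  "subst_poly u (Poly_Mapping.single m c) = constp c * (\<Prod>i\<in>UNIV. u i ^ Poly_Mapping.lookup m i)"
  by (cases "c = 0") (simp_all add: subst_poly_def)

lemma subst_poly_mult: "subst_poly u (f * g) = subst_poly u f * subst_poly u g"
proof (induction f rule: poly3_induct)
  case zero then show ?case by simp
next
  case (add m c f)
  have "subst_poly u (Poly_Mapping.single m c * g) =
      subst_poly u (Poly_Mapping.single m c) * subst_poly u g"
    by (induction g rule: poly3_induct)
      (simp_all add: subst_poly_add subst_poly_single distrib_left mult_single constp_mult
        lookup_add power_add prod.distrib mult_ac)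
  then show ?case
    using add by (simp add: distrib_right subst_poly_add)
qed

lemma subst_poly_constp: "subst_poly u (constp c) = constp c"
  unfolding constp_def subst_poly_single by (simp add: constp_def)

lemma subst_poly_varp: "subst_poly u (varp i) = u i"
proof -
  have "subst_poly u (varp i) = (\<Prod>k\<in>UNIV. if k = i then u k else 1)"
    unfolding varp_def subst_poly_single constp_1 mult_1
    by (rule prod.cong) (auto simp: lookup_single when_def)
  then show ?thesis by simp
qed

lemma subst_poly_id: "subst_poly varp f = f"
  by (induction f rule: poly3_induct)
    (simp_all only: subst_poly_0 subst_poly_add subst_poly_single single_eq_constp_varp[symmetric])

lemma ring_ideal_cong_mult:
  assumes J: "ring_ideal J" and "a - b \<in> J" "c - d \<in> J"
  shows "a * c - b * d \<in> J"
proof -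
  have "a * c - b * d = a * (c - d) + d * (a - b)" by (simp add: algebra_simps)
  then show ?thesis using ring_idealD(2,3)[OF J] assms(2,3) by metis
qed

lemma subst_poly_cong:
  assumes J: "ring_ideal J" and uw: "\<And>i. u i - w i \<in> J"
  shows "subst_poly u f - subst_poly w f \<in> J"
proof (induction f rule: poly3_induct)
  case zero show ?case using ring_idealD(1)[OF J] by simp
next
  case (add m c f)
  have pow: "u i ^ k - w i ^ k \<in> J" for i k
    by (induction k) (auto intro!: ring_ideal_cong_mult[OF J] uw ring_idealD(1)[OF J])
  have "(\<Prod>i\<in>A. u i ^ Poly_Mapping.lookup m i) - (\<Prod>i\<in>A. w i ^ Poly_Mapping.lookup m i) \<in> J"
    if "finite A" for A
    using that by induction (auto intro!: ring_ideal_cong_mult[OF J] pow ring_idealD(1)[OF J])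
  then have "subst_poly u (Poly_Mapping.single m c) - subst_poly w (Poly_Mapping.single m c) \<in> J"
    unfolding subst_poly_single
    by (intro ring_ideal_cong_mult[OF J]) (auto intro: ring_idealD(1)[OF J])
  from ring_idealD(2)[OF J this add] show ?case
    by (simp add: subst_poly_add algebra_simps)
qed

text \<open>Restriction of a form to the line spanned by \<open>v\<close>, with \<open>l\<close> as the coordinate on it.\<close>
lemma subst_poly_form:
  assumes "form d f"
  shows "subst_poly (\<lambda>i. constp (vec_nth v i) * l) f = constp (eval3 f v) * l ^ d"
proof -
  have "constp (Poly_Mapping.lookup f m) *
      (\<Prod>i\<in>UNIV. (constp (vec_nth v i) * l) ^ Poly_Mapping.lookup m i) =
      constp (Poly_Mapping.lookup f m * eval_monom m v) * l ^ d"
    if "m \<in> Poly_Mapping.keys f" for m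
  proof -
    have "(\<Sum>i\<in>UNIV. Poly_Mapping.lookup m i) = d" using assms that by (simp add: form_def)
    then show ?thesis
      by (simp add: eval_monom_def constp_mult constp_prod constp_power power_mult_distrib
          prod.distrib power_sum[symmetric] mult.assoc)
  qed
  then show ?thesis
    unfolding subst_poly_def eval3_def constp_sum sum_distrib_right by simp
qed

text \<open>The value at \<open>v\<close> of the linear form with coefficient vector \<open>a\<close>.\<close>
definition dot3 :: "'a::field^3 \<Rightarrow> 'a^3 \<Rightarrow> 'a" where
  "dot3 a v = (\<Sum>i\<in>UNIV. vec_nth a i * vec_nth v i)"

text \<open>The linear form with coefficient vector \<open>a\<close>, as a polynomial.\<close>
definition lin :: "'a::field^3 \<Rightarrow> 'a poly3" where
  "lin a = (\<Sum>i\<in>UNIV. constp (vec_nth a i) * varp i)"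

lemma dot3_add: "dot3 a (v + w) = dot3 a v + dot3 a w" "dot3 (a + b) v = dot3 a v + dot3 b v"
  by (simp_all add: dot3_def algebra_simps sum.distrib)

lemma dot3_scale: "dot3 a (c *s v) = c * dot3 a v" "dot3 (c *s a) v = c * dot3 a v"
  by (simp_all add: dot3_def sum_distrib_left mult_ac)

lemma dot3_0 [simp]: "dot3 a 0 = 0" "dot3 0 v = 0"
  by (simp_all add: dot3_def)

lemma dot3_axis: "dot3 (axis i 1) v = vec_nth v i" "dot3 v (axis i 1) = vec_nth v i"
proof -
  have "dot3 (axis i 1) v = (\<Sum>k\<in>UNIV. if k = i then vec_nth v k else 0)"
    unfolding dot3_def by (rule sum.cong) (auto simp: axis_def)
  then show "dot3 (axis i 1) v = vec_nth v i" by simp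
  then show "dot3 v (axis i 1) = vec_nth v i" by (simp add: dot3_def mult.commute)
qed

lemma lin_add: "lin (a + b) = lin a + lin b"
  by (simp add: lin_def constp_add distrib_right sum.distrib)

lemma lin_scale: "lin (c *s a) = constp c * lin a"
  by (simp add: lin_def constp_mult sum_distrib_left mult_ac)

lemma lin_axis: "lin (axis i 1) = varp i"
proof -
  have "lin (axis i 1) = (\<Sum>k\<in>UNIV. if k = i then varp k else 0)"
    unfolding lin_def by (rule sum.cong) (auto simp: axis_def)
  then show ?thesis by simp
qed

lemma eval3_lin: "eval3 (lin a) v = dot3 a v"
proof -
  have "eval3 (\<Sum>i\<in>A. g i) v = (\<Sum>i\<in>A. eval3 (g i) v)" for A :: "3 set" and g :: "3 \<Rightarrow> 'a poly3"
    by (induction A rule: infinite_finite_induct) (simp_all add: eval3_add)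
  moreover have "eval3 (varp i) v = vec_nth v i" for i
  proof -
    have "eval3 (varp i) v = (\<Prod>k\<in>UNIV. if k = i then vec_nth v k else 1)"
      unfolding varp_def eval3_single eval_monom_def mult_1
      by (rule prod.cong) (auto simp: lookup_single when_def)
    then show ?thesis by simp
  qed
  moreover have "eval3 (constp c) v = c" for c
    by (simp add: constp_def eval3_single eval_monom_def)
  ultimately show ?thesis by (simp add: lin_def dot3_def eval3_mult)
qed

lemma subst_poly_lin: "subst_poly u (lin a) = (\<Sum>i\<in>UNIV. constp (vec_nth a i) * u i)"
  by (simp add: lin_def subst_poly_sum subst_poly_mult subst_poly_constp subst_poly_varp)

lemma lookup_lin:
  "Poly_Mapping.lookup (lin a) m = (\<Sum>i\<in>UNIV. if m = Poly_Mapping.single i 1 then vec_nth a i else 0)"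
proof -
  have "constp (vec_nth a i) * varp i = Poly_Mapping.single (Poly_Mapping.single i 1) (vec_nth a i)" for i
    by (simp add: constp_def varp_def mult_single)
  then show ?thesis
    by (auto simp: lin_def lookup_sum lookup_single when_def intro!: sum.cong)
qed

lemma form_lin: "form 1 (lin a)"
  unfolding form_def
proof
  fix m assume "m \<in> Poly_Mapping.keys (lin a)"
  then have "(\<Sum>i\<in>UNIV. if m = Poly_Mapping.single i 1 then vec_nth a i else 0) \<noteq> 0"
    by (simp add: in_keys_iff lookup_lin)
  then obtain j where "(if m = Poly_Mapping.single j 1 then vec_nth a j else 0) \<noteq> 0"
    by (rule sum.not_neutral_contains_not_neutral)
  then have "m = Poly_Mapping.single j 1" by (simp split: if_splits)
  then show "(\<Sum>i\<in>UNIV. Poly_Mapping.lookup m i) = 1" by (simp add: lookup_single when_def)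
qed

lemma form_1_imp_lin:
  assumes "form 1 l"
  obtains a where "l = lin a"
proof
  let ?a = "\<chi> i. Poly_Mapping.lookup l (Poly_Mapping.single i 1)"
  show "l = lin ?a"
  proof (rule poly_mapping_eqI)
    fix m
    show "Poly_Mapping.lookup l m = Poly_Mapping.lookup (lin ?a) m"
    proof (cases "\<exists>j. m = Poly_Mapping.single j 1")
      case True
      then obtain j where j: "m = Poly_Mapping.single j 1" by blast
      have "m = Poly_Mapping.single i 1 \<longleftrightarrow> i = j" for i
        unfolding j by (metis lookup_single_eq lookup_single_not_eq zero_neq_one)
      then show ?thesis by (simp add: lookup_lin j)
    next
      case False
      have "m \<notin> Poly_Mapping.keys l"
      proof
        assume "m \<in> Poly_Mapping.keys l"
        then have "(\<Sum>i\<in>UNIV. Poly_Mapping.lookup m i) = 1" using assms by (simp add: form_def)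
        then obtain j where j: "Poly_Mapping.lookup m j = 1" "\<And>i. i \<noteq> j \<Longrightarrow> Poly_Mapping.lookup m i = 0"
          using sum_eq_1_iff[of UNIV "Poly_Mapping.lookup m"] by auto
        have "m = Poly_Mapping.single j 1"
          by (rule poly_mapping_eqI) (use j in \<open>auto simp: lookup_single when_def\<close>)
        then show False using False by blast
      qed
      then show ?thesis using False by (simp add: lookup_lin in_keys_iff)
    qed
  qed
qed

lemma vanishes_at_lin:
  assumes "v \<noteq> 0"
  shows "vanishes_at (lin a) (abs_proj_plane v) \<longleftrightarrow> dot3 a v = 0"
  using form_vanishes_at[OF form_lin assms] by (simp add: eval3_lin)

lemma eval3_0_dvd: "x dvd f \<Longrightarrow> eval3 x v = 0 \<Longrightarrow> eval3 f v = 0"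
  by (auto simp: eval3_mult elim!: dvdE)

text \<open>
  Subtracting from each variable a multiple of \<open>lin a\<close> gives an endomorphism with kernel \<open>(lin a)\<close>,
  so the quotient by \<open>lin a\<close> is a domain.
\<close>
lemma prime_elem_lin:
  assumes "dot3 a e = 1"
  shows "prime_elem (lin a)"
proof -
  \<comment> \<open>The projection along \<open>e\<close> to the plane \<open>dot3 a v = 0\<close>.\<close>
  define u where "u i = varp i - constp (vec_nth e i) * lin a" for i
  have "(\<Sum>i\<in>UNIV. constp (vec_nth a i) * (constp (vec_nth e i) * lin a)) = constp (dot3 a e) * lin a"
    by (simp add: dot3_def constp_sum constp_mult sum_distrib_right mult.assoc)
  then have u0: "subst_poly u (lin a) = 0"
    using assms by (simp add: subst_poly_lin u_def right_diff_distrib sum_subtractf)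
      (simp add: lin_def)
  have dvd: "lin a dvd f \<longleftrightarrow> subst_poly u f = 0" for f
  proof
    assume "lin a dvd f"
    then show "subst_poly u f = 0" by (auto elim!: dvdE simp: subst_poly_mult u0)
  next
    assume *: "subst_poly u f = 0"
    have "ring_ideal {f. lin a dvd f}" by (auto intro!: ring_idealI)
    moreover have "varp i - u i \<in> {f. lin a dvd f}" for i by (simp add: u_def)
    ultimately have "subst_poly varp f - subst_poly u f \<in> {f. lin a dvd f}"
      by (rule subst_poly_cong)
    then show "lin a dvd f" using * by (simp add: subst_poly_id)
  qed
  have "lin a \<noteq> 0" using assms eval3_lin[of a e] by auto
  moreover have "\<not> lin a dvd 1" using eval3_0_dvd[of "lin a" 1 0] by (auto simp: eval3_lin eval3_one)
  ultimately show ?thesis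
    by (auto intro!: prime_elemI simp: dvd subst_poly_mult)
qed

text \<open>The lines with coefficient vectors \<open>a\<close> and \<open>b\<close> meet exactly in the point \<open>[v]\<close>.\<close>
definition lines_meet_at :: "'a::field^3 \<Rightarrow> 'a^3 \<Rightarrow> 'a^3 \<Rightarrow> bool" where
  "lines_meet_at a b v \<longleftrightarrow> v \<noteq> 0 \<and> dot3 a v = 0 \<and> dot3 b v = 0 \<and>
     (\<forall>w. dot3 a w = 0 \<longrightarrow> dot3 b w = 0 \<longrightarrow> (\<exists>c. w = c *s v))"

lemma ex_dot3_eq_1:
  assumes "v \<noteq> (0 :: 'a::field^3)"
  obtains l where "dot3 l v = 1"
proof -
  obtain k where "vec_nth v k \<noteq> 0" using assms by (auto simp: vec_eq_iff)
  then have "dot3 ((1 / vec_nth v k) *s axis k 1) v = 1" by (simp add: dot3_scale dot3_axis)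
  then show ?thesis using that by blast
qed

text \<open>Three linear forms without a common zero other than \<open>0\<close> have a dual basis.\<close>
lemma dual_basis:
  fixes r :: "3 \<Rightarrow> 'a::field^3"
  assumes "\<And>w. (\<And>j. dot3 (r j) w = 0) \<Longrightarrow> w = 0"
  obtains s where "\<And>i j. dot3 (r i) (s j) = (if i = j then 1 else 0)"
    and "\<And>i. axis i 1 = (\<Sum>j\<in>UNIV. vec_nth (s j) i *s r j)"
proof -
  define A :: "'a^3^3" where "A = (\<chi> i. r i)"
  have Av: "vec_nth (A *v w) i = dot3 (r i) w" for w i
    by (simp add: A_def matrix_vector_mult_def dot3_def)
  have "w = 0" if "A *v w = 0" for w
    using assms[of w] Av[of w] that by simp
  then obtain B where B: "B ** A = mat 1" using matrix_left_invertible_ker[of A] by blast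
  then have B': "A ** B = mat 1" using matrix_left_right_inverse by blast
  show ?thesis
  proof
    fix i j
    have "dot3 (r i) (\<chi> k. vec_nth (vec_nth B k) j) = vec_nth (vec_nth (A ** B) i) j"
      by (simp add: A_def matrix_matrix_mult_def dot3_def)
    then show "dot3 (r i) (\<chi> k. vec_nth (vec_nth B k) j) = (if i = j then 1 else 0)"
      by (simp add: B' mat_def)
  next
    fix i
    have "vec_nth (axis i 1) k = vec_nth (vec_nth (B ** A) i) k" for k
      by (simp add: B mat_def axis_def)
    then show "axis i 1 = (\<Sum>j\<in>UNIV. vec_nth (\<chi> k. vec_nth (vec_nth B k) j) i *s r j)"
      by (simp add: vec_eq_iff A_def matrix_matrix_mult_def)
  qed
qed

lemma lines_meet_at_basis:
  assumes abv: "lines_meet_at a b v" and l: "dot3 l v = 1"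
  obtains p q where "dot3 a p = 1" "dot3 b p = 0" "dot3 a q = 0" "dot3 b q = 1"
    and "\<And>i. axis i 1 = vec_nth p i *s a + vec_nth q i *s b + vec_nth v i *s l"
proof -
  define r :: "3 \<Rightarrow> 'a^3" where "r = (\<lambda>i. if i = 1 then a else if i = 2 then b else l)"
  have r: "r 1 = a" "r 2 = b" "r 3 = l" by (simp_all add: r_def)
  have "w = 0" if w: "\<And>j. dot3 (r j) w = 0" for w
  proof -
    obtain c where c: "w = c *s v"
      using abv w[of 1] w[of 2] unfolding lines_meet_at_def r by blast
    then have "c = 0" using w[of 3] l unfolding r by (simp add: dot3_scale)
    then show ?thesis using c by simp
  qed
  then obtain s where s: "\<And>i j. dot3 (r i) (s j) = (if i = j then 1 else 0)"
      "\<And>i. axis i 1 = (\<Sum>j\<in>UNIV. vec_nth (s j) i *s r j)"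
    using dual_basis[of r] by blast
  have ax: "axis i 1 = vec_nth (s 1) i *s a + vec_nth (s 2) i *s b + vec_nth (s 3) i *s l" for i
    using s(2)[of i] by (simp add: sum_3 r)
  have "vec_nth v i = vec_nth (s 3) i" for i
    using arg_cong[OF ax[of i], of "\<lambda>a. dot3 a v"] abv l
    by (simp add: dot3_add dot3_scale dot3_axis lines_meet_at_def)
  then show ?thesis
    using that[of "s 1" "s 2"] ax s(1)[of 1 1] s(1)[of 1 2] s(1)[of 2 1] s(1)[of 2 2]
    by (simp add: r)
qed

lemma lines_meet_at_prime:
  assumes "lines_meet_at a b v"
  shows "prime_elem (lin a)"
proof -
  obtain l where "dot3 l v = 1" using assms ex_dot3_eq_1 unfolding lines_meet_at_def by blast
  then show ?thesis using lines_meet_at_basis[OF assms] prime_elem_lin by metis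
qed

lemma lines_meet_at_regular_pair:
  assumes "lines_meet_at a b v"
  shows "regular_pair (lin a) (lin b)"
proof -
  obtain l where "dot3 l v = 1" using assms ex_dot3_eq_1 unfolding lines_meet_at_def by blast
  then obtain q where "dot3 a q = 0" "dot3 b q = 1" using lines_meet_at_basis[OF assms] by metis
  then have "\<not> lin a dvd lin b" using eval3_0_dvd[of "lin a" "lin b" q] by (auto simp: eval3_lin)
  then show ?thesis by (rule regular_pair_prime[OF lines_meet_at_prime[OF assms]])
qed

text \<open>
  The ideal of a point consists of the polynomials that restrict to the zero polynomial on the
  line through the origin that the point stands for. It is generated by the linear forms of any two
  lines that meet only there: modulo these forms every variable is a multiple of \<open>l\<close>, so every
  polynomial is congruent to its restriction.
\<close>
lemma point_ideal_eq_kernel: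
  assumes abv: "lines_meet_at a b v" and l: "dot3 l v = 1"
  shows "point_ideal (abs_proj_plane v) = {f. subst_poly (\<lambda>i. constp (vec_nth v i) * lin l) f = 0}"
    and "point_ideal (abs_proj_plane v) = gen2 (lin a) (lin b)"
proof -
  let ?u = "\<lambda>i. constp (vec_nth v i) * lin l"
  let ?N = "{f. subst_poly ?u f = 0}"
  note v = abv[unfolded lines_meet_at_def]
  have "point_ideal (abs_proj_plane v) \<subseteq> ?N"
  proof (rule point_ideal_minimal)
    show "ring_ideal ?N" by (rule ring_idealI) (simp_all add: subst_poly_add subst_poly_mult)
  next
    fix d f assume "form d f" "vanishes_at f (abs_proj_plane v)"
    then show "f \<in> ?N" using form_vanishes_at[of d f v] v by (simp add: subst_poly_form)
  qed
  moreover have "?N \<subseteq> gen2 (lin a) (lin b)"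
  proof
    fix f assume f: "f \<in> ?N"
    obtain p q where ax: "\<And>i. axis i 1 = vec_nth p i *s a + vec_nth q i *s b + vec_nth v i *s l"
      using lines_meet_at_basis[OF abv l] by metis
    have "varp i - ?u i \<in> gen2 (lin a) (lin b)" for i
    proof (rule gen2I)
      have "varp i = lin (vec_nth p i *s a + vec_nth q i *s b + vec_nth v i *s l)"
        by (metis ax lin_axis)
      then show "varp i - ?u i = lin a * constp (vec_nth p i) + lin b * constp (vec_nth q i)"
        by (simp add: lin_add lin_scale mult.commute)
    qed
    then have "subst_poly varp f - subst_poly ?u f \<in> gen2 (lin a) (lin b)"
      by (rule subst_poly_cong[OF ring_ideal_gen2])
    then show "f \<in> gen2 (lin a) (lin b)" using f by (simp add: subst_poly_id)
  qed
  moreover have "gen2 (lin a) (lin b) \<subseteq> point_ideal (abs_proj_plane v)"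
    using v by (intro gen2_minimal ring_ideal_point_ideal form_in_point_ideal[OF form_lin])
      (simp_all add: vanishes_at_lin)
  ultimately show "point_ideal (abs_proj_plane v) = ?N"
    and "point_ideal (abs_proj_plane v) = gen2 (lin a) (lin b)" by blast+
qed

lemma point_ideal_eq_gen2:
  assumes "lines_meet_at a b v"
  shows "point_ideal (abs_proj_plane v) = gen2 (lin a) (lin b)"
proof -
  obtain l where "dot3 l v = 1" using assms ex_dot3_eq_1 unfolding lines_meet_at_def by blast
  then show ?thesis by (rule point_ideal_eq_kernel[OF assms])
qed

lemma point_ideal_power_eq_pow2:
  assumes "lines_meet_at a b v"
  shows "ideal_power (point_ideal (abs_proj_plane v)) m = pow2 (lin a) (lin b) m"
  unfolding point_ideal_eq_gen2[OF assms] by (rule ideal_power_gen2)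

lemma regular_mod_point_ideal:
  assumes abv: "lines_meet_at a b v" and c: "c \<notin> point_ideal (abs_proj_plane v)"
  shows "regular_mod c (point_ideal (abs_proj_plane v))"
proof -
  obtain l where l: "dot3 l v = 1" using abv ex_dot3_eq_1 unfolding lines_meet_at_def by blast
  show ?thesis
    using c unfolding point_ideal_eq_kernel(1)[OF abv l] regular_mod_def by (simp add: subst_poly_mult)
qed

lemma notin_point_ideal:
  assumes "v \<noteq> 0" "eval3 c v \<noteq> 0"
  shows "c \<notin> point_ideal (abs_proj_plane v)"
  using point_ideal_vanishes[of c "abs_proj_plane v"] assms by (auto simp: vanishes_at_def)

section \<open>Powers of a symbolic power\<close>

text \<open>
  The ideal of \<open>q0\<close> together with the points of \<open>Q\<close>, when the ideals of the points of \<open>Q\<close> have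
  \<open>m\<close>-th powers that meet in \<open>(b, c)\<^sup>m\<close>, the polynomial \<open>b\<close> does not vanish at \<open>q0\<close>, and \<open>c\<close> has
  order exactly \<open>r\<close> at \<open>q0\<close>, even modulo \<open>b\<close>.
\<close>
locale point_configuration =
  fixes q0 :: "'a::field proj_plane" and Q :: "'a proj_plane set" and b c :: "'a poly3" and r :: nat
  assumes finite_Q: "finite Q"
    and r_pos: "r \<ge> 1"
    and b_mem: "\<And>q. q \<in> Q \<Longrightarrow> b \<in> point_ideal q"
    and c_mem: "\<And>q. q \<in> Q \<Longrightarrow> c \<in> point_ideal q"
    and Int_pow2: "\<And>m f. (\<And>q. q \<in> Q \<Longrightarrow> f \<in> ideal_power (point_ideal q) m) \<Longrightarrow> f \<in> pow2 b c m"
    and regular_b: "\<And>m. regular_mod b (ideal_power (point_ideal q0) m)"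
    and c_order_ge: "c \<in> ideal_power (point_ideal q0) r"
    and c_order_le: "\<And>m u d. c * u - b * d \<in> ideal_power (point_ideal q0) m \<Longrightarrow>
      \<exists>d'. u - b * d' \<in> ideal_power (point_ideal q0) (m - r)"
begin

abbreviation P where "P \<equiv> ideal_power (point_ideal q0)"

abbreviation symb where "symb \<equiv> symbolic_power (ideal_of_points (insert q0 Q))"

lemma ring_ideal_P: "ring_ideal (P m)"
  by (intro ring_ideal_ideal_power ring_ideal_point_ideal)

lemma P_antimono: "h \<in> P n \<Longrightarrow> m \<le> n \<Longrightarrow> h \<in> P m"
  using ideal_power_antimono[OF ring_ideal_point_ideal] by blast

lemma P_mult: "g \<in> P m \<Longrightarrow> h \<in> P n \<Longrightarrow> g * h \<in> P (m + n)"
  by (intro ideal_power_prod ring_ideal_point_ideal)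

lemma symb_eq: "symb m = P m \<inter> (\<Inter>q\<in>Q. ideal_power (point_ideal q) m)"
  using finite_Q by (simp add: symbolic_power_ideal_of_points)

lemma ring_ideal_symb: "ring_ideal (symb m)"
  using finite_Q unfolding symbolic_power_ideal_of_points[OF finite.insertI[OF finite_Q]]
  by (intro ring_ideal_INT ring_ideal_ideal_power ring_ideal_point_ideal)

lemma c_power_mem: "c ^ i \<in> P (r * i)"
  using ideal_power_pow[OF ring_ideal_point_ideal c_order_ge] .

lemma c_power_order_le:
  assumes "c ^ i * u - b * d \<in> P m"
  shows "\<exists>d'. u - b * d' \<in> P (m - r * i)"
  using assms
proof (induction i arbitrary: m d)
  case 0 then show ?case by auto
next
  case (Suc i)
  have "c * (c ^ i * u) - b * d \<in> P m" using Suc.prems by (simp add: mult.assoc)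
  then obtain d1 where "c ^ i * u - b * d1 \<in> P (m - r)" using c_order_le by blast
  then obtain d' where "u - b * d' \<in> P (m - r - r * i)" using Suc.IH by blast
  then show ?case by (auto simp: add.commute)
qed

lemma generator_in_symb:
  assumes "i + j = m" "h \<in> P (m - r * i)"
  shows "b ^ j * c ^ i * h \<in> symb m"
  unfolding symb_eq
proof (intro IntI INT_I)
  have "c ^ i * h \<in> P (r * i + (m - r * i))" by (rule P_mult[OF c_power_mem assms(2)])
  then have "c ^ i * h \<in> P m" by (rule P_antimono) simp
  then show "b ^ j * c ^ i * h \<in> P m"
    using ring_idealD(3)[OF ring_ideal_P] by (simp add: mult.assoc)
next
  fix q assume q: "q \<in> Q"
  note J = ring_ideal_point_ideal[of q]
  have "b ^ j \<in> ideal_power (point_ideal q) j" "c ^ i \<in> ideal_power (point_ideal q) i"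
    using ideal_power_pow[OF J ideal_power_1[OF b_mem[OF q]], of j]
      ideal_power_pow[OF J ideal_power_1[OF c_mem[OF q]], of i] by simp_all
  then have "b ^ j * c ^ i \<in> ideal_power (point_ideal q) (j + i)" by (rule ideal_power_prod[OF J])
  then show "b ^ j * c ^ i * h \<in> ideal_power (point_ideal q) m"
    using ring_idealD(4)[OF ring_ideal_ideal_power[OF J]] assms(1) by (simp add: add.commute)
qed

text \<open>The symbolic power is generated by the products \<open>b\<^sup>j c\<^sup>i h\<close> that visibly belong to it.\<close>
lemma symb_induct:
  assumes "f \<in> symb m"
    and "\<And>g h. g \<in> T \<Longrightarrow> h \<in> T \<Longrightarrow> g + h \<in> T"
    and "\<And>i j h. i + j = m \<Longrightarrow> h \<in> P (m - r * i) \<Longrightarrow> b ^ j * c ^ i * h \<in> T"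
  shows "f \<in> T"
proof (rule pow2_Int_filtration[where P = P and b = b and c = c and r = r and k = m and m = m])
  show "f \<in> pow2 b c m" "f \<in> P m" using assms(1) Int_pow2 by (auto simp: symb_eq)
  fix i m h assume "h \<in> P (m - r * i)"
  then have "c ^ i * h \<in> P (r * i + (m - r * i))" by (rule P_mult[OF c_power_mem])
  then show "c ^ i * h \<in> P m" by (rule P_antimono) simp
qed (fact ring_ideal_P regular_b c_power_order_le assms)+

text \<open>
  The balance point is \<open>i = s t\<close>: for \<open>i \<ge> s t\<close> the factor \<open>h\<close> is unconstrained and the exponents
  are shared out with at least \<open>s\<close> factors \<open>c\<close> each; for \<open>i < s t\<close> each share has at most \<open>s\<close>
  factors \<open>c\<close>, and \<open>h\<close> splits accordingly.
\<close>
lemma generator_in_power: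
  assumes "i + j = r * s * t" "h \<in> P (r * s * t - r * i)"
  shows "b ^ j * c ^ i * h \<in> ideal_power (symb (r * s)) t"
  using assms
proof (induction t arbitrary: i j h)
  case 0 show ?case by simp
next
  case (Suc t)
  define e where "e = r * s"
  note J = ring_ideal_symb[of "r * s"]
  have se: "s \<le> e" using r_pos by (simp add: e_def)
  have ij: "i + j = e * t + e" using Suc.prems(1) by (simp add: e_def algebra_simps)
  have ste: "s * t \<le> e * t" using se by simp
  show ?case
  proof (cases "s * t + s \<le> i")
    case True
    \<comment> \<open>The last factor takes at least \<open>s\<close> factors \<open>c\<close>, and enough of them to leave at most the
      number that \<open>t\<close> factors can hold.\<close>
    define i1 where "i1 = max s (i - e * t)"
    have i1: "s \<le> i1" "i1 \<le> e" "i1 \<le> i" "i - i1 \<le> e * t" "s * t \<le> i - i1" "e - i1 \<le> j"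
      using True ij se ste unfolding i1_def by linarith+
    have sums: "i1 + (e - i1) = e" "i - i1 + (j - (e - i1)) = e * t" using i1 ij by linarith+
    have "r * s \<le> r * i1" "r * (s * t) \<le> r * (i - i1)" using i1 by simp_all
    then have "r * s - r * i1 = 0" "r * s * t - r * (i - i1) = 0" by (simp_all add: mult.assoc)
    then have "b ^ (e - i1) * c ^ i1 * 1 \<in> symb (r * s)"
      and "b ^ (j - (e - i1)) * c ^ (i - i1) * h \<in> ideal_power (symb (r * s)) t"
      using sums by (intro generator_in_symb Suc.IH; simp add: e_def)+
    then have "(b ^ (j - (e - i1)) * c ^ (i - i1) * h) * (b ^ (e - i1) * c ^ i1 * 1)
        \<in> ideal_power (symb (r * s)) (Suc t)"
      by (intro ideal_power_mult)
    also have "(b ^ (j - (e - i1)) * c ^ (i - i1) * h) * (b ^ (e - i1) * c ^ i1 * 1) =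
        (b ^ (j - (e - i1)) * b ^ (e - i1)) * (c ^ (i - i1) * c ^ i1) * h" by (simp add: mult_ac)
    also have "\<dots> = b ^ j * c ^ i * h" using i1 by (simp add: power_add[symmetric])
    finally show ?thesis .
  next
    case False
    define i1 where "i1 = min s i"
    have i1: "i1 \<le> s" "i1 \<le> i" "i - i1 \<le> s * t" "i - i1 \<le> e * t" "e - i1 \<le> j"
      using False ij se ste unfolding i1_def by linarith+
    have sums: "i1 + (e - i1) = e" "i - i1 + (j - (e - i1)) = e * t" using i1 ij se by linarith+
    have le: "r * i1 \<le> r * s" "r * (i - i1) \<le> r * s * t" using i1 by (simp_all add: mult.assoc)
    have ri: "r * i = r * i1 + r * (i - i1)" using i1(2) by (simp add: add_mult_distrib2[symmetric])
    have "r * s * Suc t - r * i = (r * s * t - r * (i - i1)) + (r * s - r * i1)"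
      using le unfolding ri by simp
    then have "h \<in> P ((r * s * t - r * (i - i1)) + (r * s - r * i1))" using Suc.prems(2) by simp
    then have "h \<in> {h. b ^ j * c ^ i * h \<in> ideal_power (symb (r * s)) (Suc t)}"
    proof (rule ideal_power_add_induct)
      fix g h assume "g \<in> P (r * s * t - r * (i - i1))" "h \<in> P (r * s - r * i1)"
      then have "b ^ (j - (e - i1)) * c ^ (i - i1) * g \<in> ideal_power (symb (r * s)) t"
        and "b ^ (e - i1) * c ^ i1 * h \<in> symb (r * s)"
        using sums by (intro generator_in_symb Suc.IH; simp add: e_def)+
      then have "(b ^ (j - (e - i1)) * c ^ (i - i1) * g) * (b ^ (e - i1) * c ^ i1 * h)
          \<in> ideal_power (symb (r * s)) (Suc t)"
        by (intro ideal_power_mult)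
      also have "(b ^ (j - (e - i1)) * c ^ (i - i1) * g) * (b ^ (e - i1) * c ^ i1 * h) =
          (b ^ (j - (e - i1)) * b ^ (e - i1)) * (c ^ (i - i1) * c ^ i1) * (g * h)"
        by (simp add: mult_ac)
      also have "\<dots> = b ^ j * c ^ i * (g * h)" using i1 by (simp add: power_add[symmetric])
      finally show "g * h \<in> {h. b ^ j * c ^ i * h \<in> ideal_power (symb (r * s)) (Suc t)}" by simp
    qed (use ring_idealD(2)[OF ring_ideal_ideal_power[OF J]] in \<open>auto simp: distrib_left\<close>)
    then show ?thesis by simp
  qed
qed

lemma power_symb_subset: "ideal_power (symb e) t \<subseteq> symb (e * t)"
proof -
  have "ideal_power (symb e) t \<subseteq> ideal_power (point_ideal q) (e * t)" if "q = q0 \<or> q \<in> Q" for q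
    by (rule ideal_power_power_subset[OF ring_ideal_point_ideal]) (use that in \<open>auto simp: symb_eq\<close>)
  then show ?thesis unfolding symb_eq[of "e * t"] by (intro Int_greatest INT_greatest) simp_all
qed

lemma symb_power_eq: "symb (r * s * t) = ideal_power (symb (r * s)) t"
proof (rule equalityI[OF _ power_symb_subset])
  show "symb (r * s * t) \<subseteq> ideal_power (symb (r * s)) t"
  proof
    fix f assume "f \<in> symb (r * s * t)"
    then show "f \<in> ideal_power (symb (r * s)) t"
      by (rule symb_induct)
        (rule ring_idealD(2)[OF ring_ideal_ideal_power[OF ring_ideal_symb]] generator_in_power;
          assumption)+
  qed
qed

text \<open>
  The polynomials of weighted order at least \<open>w\<close>, where \<open>b\<close> has weight \<open>\<mu>\<close> and the elements of the
  ideal of \<open>q0\<close> have weight one.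
\<close>
inductive_set weight_ge :: "nat \<Rightarrow> nat \<Rightarrow> 'a poly3 set" for \<mu> w where
  base: "h \<in> P (w - \<mu> * j) \<Longrightarrow> b ^ j * h \<in> weight_ge \<mu> w"
| add: "f \<in> weight_ge \<mu> w \<Longrightarrow> g \<in> weight_ge \<mu> w \<Longrightarrow> f + g \<in> weight_ge \<mu> w"

lemma weight_ge_mult:
  assumes "f \<in> weight_ge \<mu> w" "g \<in> weight_ge \<mu> w'"
  shows "f * g \<in> weight_ge \<mu> (w + w')"
  using assms(1)
proof induction
  case (base h j)
  note h = base
  show ?case using assms(2)
  proof induction
    case (base h' j')
    have "h * h' \<in> P (w - \<mu> * j + (w' - \<mu> * j'))" by (rule P_mult[OF h base])
    then have "h * h' \<in> P (w + w' - \<mu> * (j + j'))"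
      by (rule P_antimono) (simp add: add_mult_distrib2)
    then have "b ^ (j + j') * (h * h') \<in> weight_ge \<mu> (w + w')" by (rule weight_ge.base)
    then show ?case by (simp add: power_add mult_ac)
  next
    case (add f g)
    then show ?case by (simp add: distrib_left weight_ge.add)
  qed
next
  case (add f g)
  then show ?case by (simp add: distrib_right weight_ge.add)
qed

lemma P_subset_weight_ge: "h \<in> P w \<Longrightarrow> h \<in> weight_ge \<mu> w"
  using weight_ge.base[of h w \<mu> 0] by simp

lemma weight_ge_decompose:
  assumes "f \<in> weight_ge \<mu> w"
  shows "\<exists>p g. f = p + b * g \<and> p \<in> P w \<and> g \<in> weight_ge \<mu> (w - \<mu>)"
  using assms
proof induction
  case (base h j)
  have z: "0 \<in> P m" for m by (rule ring_idealD(1)[OF ring_ideal_P])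
  show ?case
  proof (cases j)
    case 0
    have "b ^ j * h = h + b * 0" using 0 by simp
    then show ?thesis using base 0 P_subset_weight_ge[OF z] by (metis diff_zero mult_0_right)
  next
    case (Suc i)
    have "h \<in> P (w - \<mu> - \<mu> * i)" using base Suc by simp
    then have "b ^ i * h \<in> weight_ge \<mu> (w - \<mu>)" by (rule weight_ge.base)
    moreover have "b ^ j * h = 0 + b * (b ^ i * h)" using Suc by (simp add: mult.assoc)
    ultimately show ?thesis using z by blast
  qed
next
  case (add f g)
  then obtain p q p' q' where "f = p + b * q" "p \<in> P w" "q \<in> weight_ge \<mu> (w - \<mu>)"
    "g = p' + b * q'" "p' \<in> P w" "q' \<in> weight_ge \<mu> (w - \<mu>)" by blast
  then show ?case
    by (intro exI[of _ "p + p'"] exI[of _ "q + q'"])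
      (simp add: algebra_simps weight_ge.add ring_idealD(2)[OF ring_ideal_P])
qed

lemma weight_ge_cancel_power:
  assumes "b ^ j * u \<in> weight_ge \<mu> w"
  shows "u \<in> weight_ge \<mu> (w - \<mu> * j)"
  using assms
proof (induction j arbitrary: w)
  case 0 then show ?case by simp
next
  case (Suc j)
  obtain p g where pg: "b ^ Suc j * u = p + b * g" "p \<in> P w" "g \<in> weight_ge \<mu> (w - \<mu>)"
    using weight_ge_decompose[OF Suc.prems] by blast
  have "b * (b ^ j * u - g) = p" using pg(1) by (simp add: algebra_simps)
  then have "b ^ j * u - g \<in> P w" using pg(2) regular_modD[OF regular_b] by metis
  then have "b ^ j * u - g \<in> P (w - \<mu>)" by (rule P_antimono) simp
  then have "(b ^ j * u - g) + g \<in> weight_ge \<mu> (w - \<mu>)"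
    by (intro weight_ge.add P_subset_weight_ge pg(3))
  then have "u \<in> weight_ge \<mu> (w - \<mu> - \<mu> * j)" by (intro Suc.IH) simp
  then show ?case by simp
qed

lemma symb_weight_ge:
  assumes "e < r" "f \<in> symb e"
  shows "f \<in> weight_ge (r - e) ((r - e) * e + e)"
  using assms(2)
proof (rule symb_induct)
  fix i j h assume ij: "i + j = e" and h: "h \<in> P (e - r * i)"
  have "c ^ i * h \<in> P ((r - e) * e + e - (r - e) * j)"
  proof (cases "i = 0")
    case True
    then show ?thesis using ij h by simp
  next
    case False
    have "c ^ i * h \<in> P (r * i)" by (rule ring_idealD(4)[OF ring_ideal_P c_power_mem])
    moreover have "(r - e) * e + e - (r - e) * j = (r - e) * i + e"
      using ij by (auto simp: add_mult_distrib2)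
    moreover have "(r - e) * i + e \<le> (r - e) * i + e * i" using False by simp
    moreover have "\<dots> = r * i" using assms(1) by (simp add: add_mult_distrib[symmetric])
    ultimately show ?thesis using P_antimono by metis
  qed
  then have "b ^ j * (c ^ i * h) \<in> weight_ge (r - e) ((r - e) * e + e)" by (rule weight_ge.base)
  then show "b ^ j * c ^ i * h \<in> weight_ge (r - e) ((r - e) * e + e)" by (simp add: mult.assoc)
qed (rule weight_ge.add)

text \<open>
  For \<open>e < r\<close> the element \<open>b\<^sup>e\<^sup>r\<^sup>-\<^sup>e c\<^sup>e\<close> belongs to the symbolic power of exponent \<open>e r\<close>, but with
  weight \<open>r - e\<close> for \<open>b\<close> it is too light for the \<open>r\<close>-th power of the symbolic power of exponent \<open>e\<close>.
\<close>
lemma symb_power_neq: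
  assumes e: "1 \<le> e" "e < r" and proper: "\<And>d. 1 - b * d \<notin> P 1"
  shows "symb (e * r) \<noteq> ideal_power (symb e) r"
proof
  assume eq: "symb (e * r) = ideal_power (symb e) r"
  define \<mu> where "\<mu> = r - e"
  define w where "w = \<mu> * e + e"
  have pow: "ideal_power (symb e) t \<subseteq> weight_ge \<mu> (w * t)" for t
  proof (induction t)
    case 0 show ?case by (auto intro: P_subset_weight_ge)
  next
    case (Suc t)
    show ?case
    proof
      fix f assume "f \<in> ideal_power (symb e) (Suc t)"
      then show "f \<in> weight_ge \<mu> (w * Suc t)"
      proof (induction rule: ideal_power_Suc_induct)
        case (mult g h)
        then have "g * h \<in> weight_ge \<mu> (w * t + w)"
          using Suc symb_weight_ge[OF e(2)] unfolding \<mu>_def w_def by (intro weight_ge_mult) auto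
        then show ?case by (simp add: add.commute)
      qed (rule weight_ge.add)
    qed
  qed
  define J where "J = e * r - e"
  have "b ^ J * c ^ e * 1 \<in> symb (e * r)"
    using r_pos by (intro generator_in_symb) (simp_all add: J_def mult.commute)
  then have "b ^ J * c ^ e \<in> weight_ge \<mu> (w * r)" using eq pow by auto
  then have "c ^ e \<in> weight_ge \<mu> (w * r - \<mu> * J)" by (rule weight_ge_cancel_power)
  then obtain p g where "c ^ e = p + b * g" "p \<in> P (w * r - \<mu> * J)"
    using weight_ge_decompose by blast
  then have "c ^ e * 1 - b * g \<in> P (w * r - \<mu> * J)" by simp
  then obtain d where d: "1 - b * d \<in> P (w * r - \<mu> * J - r * e)" using c_power_order_le by blast
  have "e \<le> e * r" using r_pos by simp
  then have "J + e = e * r" by (simp add: J_def)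
  then have "\<mu> * J + \<mu> * e = \<mu> * e * r" by (simp add: mult.assoc add_mult_distrib2[symmetric])
  moreover have "w * r = \<mu> * e * r + r * e" by (simp add: w_def algebra_simps)
  ultimately have "w * r - \<mu> * J - r * e = \<mu> * e" by simp
  moreover have "1 \<le> \<mu> * e" using e by (simp add: \<mu>_def)
  ultimately have "1 - b * d \<in> P 1" using d P_antimono by metis
  then show False using proper by blast
qed

lemma least_exponent:
  assumes "\<And>d. 1 - b * d \<notin> P 1"
  shows "r = (LEAST e. e \<ge> 1 \<and> (\<forall>t\<ge>1. symb (e * t) = ideal_power (symb e) t))"
proof (rule Least_equality[symmetric])
  show "r \<ge> 1 \<and> (\<forall>t\<ge>1. symb (r * t) = ideal_power (symb r) t)"
    using symb_power_eq[of 1] r_pos by simp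
next
  fix e assume e: "e \<ge> 1 \<and> (\<forall>t\<ge>1. symb (e * t) = ideal_power (symb e) t)"
  show "r \<le> e"
  proof (rule ccontr)
    assume "\<not> r \<le> e"
    then show False using symb_power_neq[of e] e assms r_pos by auto
  qed
qed

end

section \<open>Points on a line\<close>

lemma regular_pair_prod:
  assumes "x \<noteq> 0" "\<And>i. i \<in> S \<Longrightarrow> regular_pair x (y i)"
  shows "regular_pair x (\<Prod>i\<in>S. y i)"
  using assms(2)
proof (induction S rule: infinite_finite_induct)
  case (insert i S)
  then have "regular_pair x (y i)" "regular_pair x (\<Prod>i\<in>S. y i)" by simp_all
  then have "regular_pair x (y i * (\<Prod>i\<in>S. y i))"
    unfolding regular_pair_def mult.assoc by blast
  then show ?case using insert.hyps by simp
qed (use assms(1) in \<open>simp_all add: regular_pair_def\<close>)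

lemma pow2_commute:
  fixes x y :: "'a::field poly3"
  shows "pow2 x y m = pow2 y x m"
  by (metis ideal_power_gen2 gen2_commute)

lemma pow2_cong_mod:
  fixes x y :: "'a::field poly3"
  assumes "x dvd y' - y"
  shows "pow2 x y m = pow2 x y' m"
proof -
  obtain w where w: "y' = y + x * w" using assms by (metis dvdE add.commute diff_add_cancel)
  have "y' \<in> gen2 x y" by (rule gen2I[of _ _ w _ 1]) (simp add: w)
  moreover have "y \<in> gen2 x y'" by (rule gen2I[of _ _ "- w" _ 1]) (simp add: w)
  ultimately have "gen2 x y = gen2 x y'"
    by (intro equalityI gen2_minimal ring_ideal_gen2 gen2_mem)
  then show ?thesis by (metis ideal_power_gen2)
qed

lemma proj_plane_eqI:
  assumes "v \<noteq> 0" "w \<noteq> 0" "w = k *s v"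
  shows "abs_proj_plane v = abs_proj_plane w"
proof -
  have "k \<noteq> 0" using assms by auto
  then have "proportional v w" using assms by (auto simp: proportional_def)
  then show ?thesis using assms abs_proj_plane_eq_iff by blast
qed

lemma lines_meet_at_unique:
  assumes "lines_meet_at a b v" "w \<noteq> 0" "dot3 a w = 0" "abs_proj_plane w \<noteq> abs_proj_plane v"
  shows "dot3 b w \<noteq> 0"
  using assms proj_plane_eqI[of v w] unfolding lines_meet_at_def by metis

text \<open>
  Points of the line \<open>a\<close> cut out on it by further lines \<open>b\<^sub>i\<close>: their ideals are
  \<open>(a, b\<^sub>i)\<close>, and the \<open>m\<close>-th powers of these meet in the \<open>m\<close>-th power of the complete
  intersection \<open>(a, \<Prod> b\<^sub>i)\<close>.
\<close>
lemma collinear_Int_powers: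
  fixes v :: "'i \<Rightarrow> 'a::field^3"
  assumes "finite S"
    and "\<And>i. i \<in> S \<Longrightarrow> lines_meet_at a (b i) (v i)"
    and "\<And>i j. i \<in> S \<Longrightarrow> j \<in> S \<Longrightarrow> i \<noteq> j \<Longrightarrow> dot3 (b i) (v j) \<noteq> 0"
    and "\<And>i. i \<in> S \<Longrightarrow> f \<in> ideal_power (point_ideal (abs_proj_plane (v i))) m"
  shows "f \<in> pow2 (lin a) (\<Prod>i\<in>S. lin (b i)) m"
  using assms
proof (induction S rule: finite_induct)
  case empty
  show ?case using pow2_y[of 1 m f "lin a"] by simp
next
  case (insert j S)
  note meet = insert.prems(1)
  have "f \<in> pow2 (lin a) (\<Prod>i\<in>S. lin (b i)) m" by (rule insert.IH) (use insert.prems in auto)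
  moreover have "f \<in> pow2 (lin a) (lin (b j)) m"
    using insert.prems(3)[of j] point_ideal_power_eq_pow2[OF meet[of j]] by simp
  moreover have "pow2 (lin a) (\<Prod>i\<in>S. lin (b i)) m \<inter> pow2 (lin a) (lin (b j)) m
      \<subseteq> pow2 (lin a) ((\<Prod>i\<in>S. lin (b i)) * lin (b j)) m"
  proof (rule pow2_Int)
    show j: "regular_pair (lin a) (lin (b j))"
      by (rule lines_meet_at_regular_pair[OF meet]) simp
    show "regular_pair (lin a) (\<Prod>i\<in>S. lin (b i))"
      using j meet by (intro regular_pair_prod lines_meet_at_regular_pair) (auto simp: regular_pair_def)
    have mj: "lines_meet_at a (b j) (v j)" using meet by simp
    show "regular_mod (\<Prod>i\<in>S. lin (b i)) (gen2 (lin a) (lin (b j)))"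
      unfolding point_ideal_eq_gen2[OF mj, symmetric]
    proof (intro regular_mod_prod regular_mod_point_ideal[OF mj] notin_point_ideal)
      show "v j \<noteq> 0" using mj by (simp add: lines_meet_at_def)
      fix i assume "i \<in> S"
      then show "eval3 (lin (b i)) (v j) \<noteq> 0"
        using insert.prems(2)[of i j] insert.hyps(2) by (auto simp: eval3_lin)
    qed
  qed
  ultimately have "f \<in> pow2 (lin a) ((\<Prod>i\<in>S. lin (b i)) * lin (b j)) m" by blast
  then show ?case using insert.hyps by (simp add: mult.commute)
qed

lemma ex_lines_meet_at:
  fixes v :: "'a::field^3"
  assumes "v \<noteq> 0"
  obtains a b where "lines_meet_at a b v"
proof -
  have *: "\<exists>a b. lines_meet_at a b v"
    if k: "vec_nth v k \<noteq> 0" and all: "\<And>l. l = k \<or> l = i \<or> l = j" for i j k :: 3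
  proof (intro exI)
    let ?a = "\<lambda>i. vec_nth v k *s axis i 1 + (- vec_nth v i) *s axis k 1"
    have d: "dot3 (?a i) w = vec_nth v k * vec_nth w i - vec_nth v i * vec_nth w k" for i w
      by (simp only: dot3_add dot3_scale dot3_axis) simp
    show "lines_meet_at (?a i) (?a j) v"
      unfolding lines_meet_at_def d
    proof (intro conjI allI impI)
      fix w assume i: "vec_nth v k * vec_nth w i - vec_nth v i * vec_nth w k = 0"
        and j: "vec_nth v k * vec_nth w j - vec_nth v j * vec_nth w k = 0"
      have "vec_nth w l = vec_nth w k / vec_nth v k * vec_nth v l" for l
        using all[of l] i j k by (auto simp: field_simps)
      then show "\<exists>c. w = c *s v" unfolding vec_eq_iff vector_smult_component by blast
    qed (use assms in simp_all)
  qed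
  have "vec_nth v 1 \<noteq> 0 \<or> vec_nth v 2 \<noteq> 0 \<or> vec_nth v 3 \<noteq> 0"
    using assms by (metis (no_types) exhaust_3 vec_eq_iff zero_index)
  then show ?thesis
  proof (elim disjE)
    assume "vec_nth v 1 \<noteq> 0"
    from *[OF this, of 2 3] show ?thesis using exhaust_3 that by blast
  next
    assume "vec_nth v 2 \<noteq> 0"
    from *[OF this, of 1 3] show ?thesis using exhaust_3 that by blast
  next
    assume "vec_nth v 3 \<noteq> 0"
    from *[OF this, of 1 2] show ?thesis using exhaust_3 that by blast
  qed
qed

lemma is_lineE:
  assumes "is_line L"
  obtains a where "\<And>v. v \<noteq> 0 \<Longrightarrow> abs_proj_plane v \<in> L \<longleftrightarrow> dot3 a v = 0"
proof -
  obtain l where l: "form 1 l" "L = {q. vanishes_at l q}" using assms by (auto simp: is_line_def)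
  obtain a where "l = lin a" using l(1) by (rule form_1_imp_lin)
  then show ?thesis using that[of a] l(2) vanishes_at_lin by blast
qed

lemma ex_representatives:
  fixes p :: "'i \<Rightarrow> 'a::field proj_plane"
  obtains v where "\<And>i. v i \<noteq> 0" "\<And>i. abs_proj_plane (v i) = p i"
proof -
  have "\<forall>i. \<exists>v. v \<noteq> 0 \<and> abs_proj_plane v = p i" using proj_plane_cases by metis
  then show ?thesis using that by metis
qed

lemma eval3_power: "eval3 (f ^ k) v = eval3 f v ^ k"
  by (induction k) (simp_all add: eval3_mult eval3_one)

lemma eval3_prod: "eval3 (\<Prod>i\<in>S. f i) v = (\<Prod>i\<in>S. eval3 (f i) v)"
  by (induction S rule: infinite_finite_induct) (simp_all add: eval3_mult eval3_one)

lemma eval3_diff: "eval3 (f - g) v = eval3 f v - eval3 g v"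
  using eval3_add[of "f - g" g v] by simp

text \<open>A line through a point has order one there, even modulo a curve that avoids the point.\<close>
lemma point_ideal_cancel_line:
  assumes ab: "lines_meet_at a b v" and c: "c \<notin> point_ideal (abs_proj_plane v)"
    and u: "lin a * u - c * d \<in> ideal_power (point_ideal (abs_proj_plane v)) m"
  shows "\<exists>d'. u - c * d' \<in> ideal_power (point_ideal (abs_proj_plane v)) (m - 1)"
proof (cases m)
  case 0 then show ?thesis by simp
next
  case (Suc k)
  have "regular_mod c (gen2 (lin a) (lin b))"
    using regular_mod_point_ideal[OF ab c] unfolding point_ideal_eq_gen2[OF ab] .
  then show ?thesis
    using pow2_cancel_x_mod[OF lines_meet_at_regular_pair[OF ab]] u
    unfolding point_ideal_power_eq_pow2[OF ab] Suc by simp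
qed

lemma regular_mod_point_ideal_power:
  assumes ab: "lines_meet_at a b v" and c: "c \<notin> point_ideal (abs_proj_plane v)"
  shows "regular_mod c (ideal_power (point_ideal (abs_proj_plane v)) m)"
  using regular_mod_point_ideal[OF ab c]
  unfolding point_ideal_eq_gen2[OF ab] ideal_power_gen2
  by (rule regular_mod_pow2[OF lines_meet_at_regular_pair[OF ab]])

section \<open>The two configurations\<close>

lemma almost_collinear_configuration:
  assumes "almost_collinear n Z"
  obtains q0 Q b c where "Z = insert q0 Q" "point_configuration q0 Q b c n"
    "\<And>d. 1 - b * d \<notin> ideal_power (point_ideal q0) 1"
proof -
  obtain p L where n: "n \<ge> 2" and inj: "inj_on p {0..n}" and Z: "Z = p ` {0..n}"
    and L: "is_line L" "p ` {1..n} \<subseteq> L" "p 0 \<notin> L"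
    using assms unfolding almost_collinear_def by blast
  obtain v where v: "\<And>i. v i \<noteq> 0" "\<And>i. abs_proj_plane (v i) = p i"
    using ex_representatives[of p] by metis
  obtain z where z: "\<And>v. v \<noteq> 0 \<Longrightarrow> abs_proj_plane v \<in> L \<longleftrightarrow> dot3 z v = 0"
    using is_lineE[OF L(1)] by blast
  have z0: "dot3 z (v 0) \<noteq> 0" using z[of "v 0"] v L(3) by simp
  have zi: "dot3 z (v i) = 0" if "i \<in> {1..n}" for i
  proof -
    have "p i \<in> L" using L(2) that by blast
    then show ?thesis using z[of "v i"] v by simp
  qed
  obtain x y where xy: "lines_meet_at x y (v 0)" using ex_lines_meet_at[OF v(1)] by metis
  \<comment> \<open>So \<open>x\<close>, \<open>y\<close>, \<open>z\<close> are linear coordinates.\<close>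
  have triv: "w = 0" if "dot3 x w = 0" "dot3 y w = 0" "dot3 z w = 0" for w
  proof -
    obtain k where "w = k *s v 0" using xy \<open>dot3 x w = 0\<close> \<open>dot3 y w = 0\<close>
      unfolding lines_meet_at_def by blast
    then show ?thesis using \<open>dot3 z w = 0\<close> z0 by (simp add: dot3_scale)
  qed
  \<comment> \<open>The line through \<open>p 0\<close> and \<open>p i\<close>.\<close>
  define l where "l i = dot3 y (v i) *s x + (- dot3 x (v i)) *s y" for i
  have dl: "dot3 (l i) w = dot3 y (v i) * dot3 x w - dot3 x (v i) * dot3 y w" for i w
    unfolding l_def dot3_add dot3_scale by simp
  have xyi: "dot3 x (v i) \<noteq> 0 \<or> dot3 y (v i) \<noteq> 0" if "i \<in> {1..n}" for i
    using triv[of "v i"] zi[OF that] v(1) by blast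
  have meet: "lines_meet_at z (l i) (v i)" if i: "i \<in> {1..n}" for i
    unfolding lines_meet_at_def
  proof (intro conjI allI impI)
    fix w assume w: "dot3 z w = 0" "dot3 (l i) w = 0"
    have eq: "dot3 y (v i) * dot3 x w = dot3 x (v i) * dot3 y w" using w(2) by (simp add: dl)
    have "\<exists>k. dot3 x w = k * dot3 x (v i) \<and> dot3 y w = k * dot3 y (v i)"
    proof (cases "dot3 x (v i) = 0")
      case True
      then show ?thesis
        using xyi[OF i] eq by (intro exI[of _ "dot3 y w / dot3 y (v i)"]) auto
    next
      case False
      then show ?thesis
        using eq by (intro exI[of _ "dot3 x w / dot3 x (v i)"]) (auto simp: field_simps)
    qed
    then obtain k where k: "dot3 x w = k * dot3 x (v i)" "dot3 y w = k * dot3 y (v i)" by blast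
    have "w + (- k) *s v i = 0"
      by (rule triv; simp only: dot3_add dot3_scale) (simp_all add: k w(1) zi[OF i])
    then have "w = k *s v i" by (simp add: add_eq_0_iff2)
    then show "\<exists>k. w = k *s v i" by blast
  qed (simp_all add: v zi[OF i] dl)
  have meet0: "\<exists>b. lines_meet_at (l i) b (v 0)" if i: "i \<in> {1..n}" for i
  proof (cases "dot3 y (v i) = 0")
    case True
    then have "lines_meet_at (l i) x (v 0)"
      using xy xyi[OF i] unfolding lines_meet_at_def dl by auto
    then show ?thesis by blast
  next
    case False
    then have "lines_meet_at (l i) y (v 0)"
      using xy unfolding lines_meet_at_def dl by auto
    then show ?thesis by blast
  qed
  define c where "c = (\<Prod>i\<in>{1..n}. lin (l i))"
  define P where "P = ideal_power (point_ideal (p 0))"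
  have zP: "lin z \<notin> point_ideal (abs_proj_plane (v 0))"
    using z0 v by (intro notin_point_ideal) (simp_all add: eval3_lin)
  have "finite S \<Longrightarrow> S \<subseteq> {1..n} \<Longrightarrow> (\<Prod>i\<in>S. lin (l i)) \<in> P (card S)" for S
  proof (induction S rule: finite_induct)
    case empty show ?case by (simp add: P_def)
  next
    case (insert i S)
    obtain b where "lines_meet_at (l i) b (v 0)" using meet0 insert.prems by blast
    then have "lin (l i) \<in> point_ideal (p 0)"
      using point_ideal_eq_gen2[of "l i" b "v 0"] gen2_mem(1) v(2) by metis
    then have "(\<Prod>i\<in>S. lin (l i)) * lin (l i) \<in> P (Suc (card S))"
      using insert unfolding P_def by (intro ideal_power_mult) simp_all
    then show ?case using insert by (simp add: mult.commute)
  qed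
  then have cP: "c \<in> P n" unfolding c_def by (metis card_atLeastAtMost diff_Suc_1 finite_atLeastAtMost subset_refl)
  have cancel: "finite S \<Longrightarrow> S \<subseteq> {1..n} \<Longrightarrow> (\<Prod>i\<in>S. lin (l i)) * u - lin z * d \<in> P m \<Longrightarrow>
      \<exists>d'. u - lin z * d' \<in> P (m - card S)" for S u d m
  proof (induction S arbitrary: m d rule: finite_induct)
    case empty then show ?case by auto
  next
    case (insert i S)
    let ?u = "(\<Prod>i\<in>S. lin (l i)) * u"
    obtain b where b: "lines_meet_at (l i) b (v 0)" using meet0 insert.prems by blast
    have "lin (l i) * ?u - lin z * d \<in> P m" using insert.prems insert.hyps by (simp add: mult.assoc)
    then obtain d1 where "?u - lin z * d1 \<in> P (m - 1)"
      using point_ideal_cancel_line[OF b zP] v(2) unfolding P_def by metis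
    then obtain d' where "u - lin z * d' \<in> P (m - 1 - card S)" using insert by blast
    then show ?case using insert.hyps by auto
  qed
  have config: "point_configuration (p 0) (p ` {1..n}) (lin z) c n"
  proof
    show "finite (p ` {1..n})" by simp
    show "n \<ge> 1" using n by simp
    fix q assume "q \<in> p ` {1..n}"
    then obtain i where i: "i \<in> {1..n}" "q = p i" by blast
    have Pi: "point_ideal q = gen2 (lin z) (lin (l i))"
      using point_ideal_eq_gen2[OF meet[OF i(1)]] i(2) v(2) by simp
    show "lin z \<in> point_ideal q" unfolding Pi by (rule gen2_mem)
    have "c = lin (l i) * (\<Prod>i\<in>{1..n} - {i}. lin (l i))"
      unfolding c_def using i(1) by (intro prod.remove) simp_all
    then show "c \<in> point_ideal q"
      unfolding Pi using ring_idealD(4)[OF ring_ideal_gen2 gen2_mem(2)] by simp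
  next
    fix m f assume f: "\<And>q. q \<in> p ` {1..n} \<Longrightarrow> f \<in> ideal_power (point_ideal q) m"
    show "f \<in> pow2 (lin z) c m"
      unfolding c_def
    proof (rule collinear_Int_powers[where v = v])
      fix i j assume ij: "i \<in> {1..n}" "j \<in> {1..n}" "i \<noteq> j"
      then have "p j \<noteq> p i" using inj by (auto simp: inj_on_def)
      then show "dot3 (l i) (v j) \<noteq> 0"
        using lines_meet_at_unique[OF meet[OF ij(1)], of "v j"] v zi[OF ij(2)] by simp
    qed (use meet f v(2) in auto)
  next
    fix m
    show "regular_mod (lin z) (ideal_power (point_ideal (p 0)) m)"
      using regular_mod_point_ideal_power[OF xy zP] v(2) by simp
  next
    show "c \<in> ideal_power (point_ideal (p 0)) n" using cP by (simp add: P_def)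
  next
    fix m u d assume "c * u - lin z * d \<in> ideal_power (point_ideal (p 0)) m"
    then show "\<exists>d'. u - lin z * d' \<in> ideal_power (point_ideal (p 0)) (m - n)"
      using cancel[of "{1..n}" u d m] by (simp add: c_def P_def)
  qed
  moreover have "1 - lin z * d \<notin> ideal_power (point_ideal (p 0)) 1" for d
  proof
    assume "1 - lin z * d \<in> ideal_power (point_ideal (p 0)) 1"
    then have "1 - lin z * d \<in> pow2 (lin x) (lin y) 1"
      using point_ideal_power_eq_pow2[OF xy] v(2) by simp
    then obtain f g where "1 - lin z * d = lin y * f + lin x * g" by auto
    \<comment> \<open>All linear forms vanish at the origin of the affine space.\<close>
    then have "eval3 (1 - lin z * d) 0 = eval3 (lin y * f + lin x * g) 0" by simp
    then show False by (simp add: eval3_diff eval3_add eval3_mult eval3_lin eval3_one)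
  qed
  moreover have "Z = insert (p 0) (p ` {1..n})"
    unfolding Z by (simp add: atLeast0_atMost_Suc image_insert[symmetric] del: image_insert)
      (simp add: atLeastAtMost_insertL[symmetric])
  ultimately show ?thesis using that by blast
qed

lemma regular_pair_swap:
  fixes b x :: "'r::idom"
  assumes "prime_elem x" "\<not> x dvd b"
  shows "regular_pair b x"
  unfolding regular_pair_def
proof (intro conjI allI impI)
  show "b \<noteq> 0" using assms(2) by auto
  fix u assume "b dvd x * u"
  then obtain d where d: "x * u = b * d" by (elim dvdE)
  then have "x dvd b * d" by (metis dvd_triv_left)
  then have "x dvd d" using assms prime_elem_dvd_multD by blast
  then obtain e where "d = x * e" by (elim dvdE)
  then have "x * u = x * (b * e)" using d by (simp add: mult_ac)
  then have "u = b * e" using assms(1) by auto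
  then show "b dvd u" by simp
qed

text \<open>One step of the permutability of the regular sequence \<open>x, y, b\<close>.\<close>
lemma regular_mod_gen2_swap:
  fixes b x y :: "'r::idom"
  assumes yx: "regular_pair y x" and b: "regular_mod b (gen2 x y)"
  shows "regular_mod x (gen2 b y)"
  unfolding regular_mod_def
proof (intro allI impI)
  fix u assume "x * u \<in> gen2 b y"
  then obtain f g where fg: "x * u = b * f + y * g" by (rule gen2E)
  then have "b * f \<in> gen2 x y" by (intro gen2I[of _ _ u _ "- g"]) simp
  then have "f \<in> gen2 x y" by (rule regular_modD[OF b])
  then obtain p q where pq: "f = x * p + y * q" by (rule gen2E)
  have "x * (u - b * p) = y * (b * q + g)" using fg pq by (simp add: algebra_simps)
  then have "y dvd u - b * p" using yx unfolding regular_pair_def by (metis dvd_triv_left)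
  then obtain d where "u - b * p = y * d" by (elim dvdE)
  then show "u \<in> gen2 b y" by (intro gen2I[of _ _ p _ d]) (simp add: algebra_simps)
qed

lemma lines_meet_at_commute: "lines_meet_at a b v \<longleftrightarrow> lines_meet_at b a v"
  unfolding lines_meet_at_def by blast

text \<open>Cutting out a point \<open>[v]\<close> of the line \<open>x\<close> by a line that differs from \<open>z\<close> by a multiple of \<open>y\<close>.\<close>
lemma lines_meet_at_shift:
  assumes xy: "lines_meet_at x y u" and z: "dot3 z u \<noteq> 0" and v: "v \<noteq> 0" "dot3 x v = 0" "dot3 y v \<noteq> 0"
  shows "lines_meet_at x (z + (- (dot3 z v / dot3 y v)) *s y) v"
  unfolding lines_meet_at_def
proof (intro conjI allI impI)
  fix w assume w: "dot3 x w = 0" "dot3 (z + (- (dot3 z v / dot3 y v)) *s y) w = 0"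
  define k where "k = dot3 y w / dot3 y v"
  define w' where "w' = w + (- k) *s v"
  have "dot3 z w = dot3 z v / dot3 y v * dot3 y w" using w(2) unfolding dot3_add dot3_scale by simp
  then have w': "dot3 x w' = 0" "dot3 y w' = 0" "dot3 z w' = 0"
    using w(1) v unfolding w'_def dot3_add dot3_scale by (simp_all add: k_def)
  obtain c where c: "w' = c *s u" using xy w'(1,2) unfolding lines_meet_at_def by blast
  then have "c = 0" using w'(3) z by (simp add: dot3_scale)
  then have "w = k *s v" using c unfolding w'_def by (simp add: add_eq_0_iff2)
  then show "\<exists>k. w = k *s v" by blast
next
  show "dot3 (z + (- (dot3 z v / dot3 y v)) *s y) v = 0"
    using v(3) unfolding dot3_add dot3_scale by simp
qed (use v in simp_all)

lemma prod_lin_shift_dvd: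
  assumes "finite S"
  shows "lin y dvd (\<Prod>i\<in>S. lin (z + k i *s y)) - lin z ^ card S"
  using assms
proof (induction S rule: finite_induct)
  case empty show ?case by simp
next
  case (insert i S)
  have J: "ring_ideal {f. lin y dvd f}" by (auto intro!: ring_idealI)
  have "lin (z + k i *s y) - lin z \<in> {f. lin y dvd f}" by (simp add: lin_add lin_scale)
  from ring_ideal_cong_mult[OF J this, of "\<Prod>i\<in>S. lin (z + k i *s y)" "lin z ^ card S"]
  show ?case using insert by simp
qed

lemma nearly_complete_intersection_configuration:
  assumes "nearly_complete_intersection n Z"
  obtains q0 Q b c where "Z = insert q0 Q" "point_configuration q0 Q b c 2"
proof -
  obtain p L1 L2 where inj: "inj_on p {0..2*n}" and Z: "Z = p ` {0..2*n}"
    and L: "is_line L1" "is_line L2" "L1 \<inter> L2 = {p 0}"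
    and on: "p ` {1..n} \<subseteq> L1 - L2" "p ` {n+1..2*n} \<subseteq> L2 - L1"
    using assms unfolding nearly_complete_intersection_def by blast
  obtain v where v: "\<And>i. v i \<noteq> 0" "\<And>i. abs_proj_plane (v i) = p i"
    using ex_representatives[of p] by metis
  obtain x where x: "\<And>v. v \<noteq> 0 \<Longrightarrow> abs_proj_plane v \<in> L1 \<longleftrightarrow> dot3 x v = 0"
    using is_lineE[OF L(1)] by blast
  obtain y where y: "\<And>v. v \<noteq> 0 \<Longrightarrow> abs_proj_plane v \<in> L2 \<longleftrightarrow> dot3 y v = 0"
    using is_lineE[OF L(2)] by blast
  have xy: "lines_meet_at x y (v 0)"
    unfolding lines_meet_at_def
  proof (intro conjI allI impI)
    show "dot3 x (v 0) = 0" "dot3 y (v 0) = 0" using x[of "v 0"] y[of "v 0"] v[of 0] L(3) by auto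
    fix w assume w: "dot3 x w = 0" "dot3 y w = 0"
    show "\<exists>k. w = k *s v 0"
    proof (cases "w = 0")
      case True then show ?thesis by (intro exI[of _ 0]) simp
    next
      case False
      then have "abs_proj_plane w \<in> L1 \<inter> L2" using w x y by simp
      then have "abs_proj_plane (v 0) = abs_proj_plane w" using L(3) v(2) by simp
      then show ?thesis using abs_proj_plane_eq_iff[OF v(1) False] by (auto simp: proportional_def)
    qed
  qed (rule v)
  note yx = xy[unfolded lines_meet_at_commute[of x]]
  obtain z where z: "dot3 z (v 0) = 1" using ex_dot3_eq_1[OF v(1)] by blast
  define S T where "S = {1..n}" and "T = {n+1..2*n}"
  have S: "dot3 x (v i) = 0" "dot3 y (v i) \<noteq> 0" if "i \<in> S" for i
  proof -
    have "p i \<in> L1 - L2" using on(1) that unfolding S_def by blast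
    then show "dot3 x (v i) = 0" "dot3 y (v i) \<noteq> 0" using x[of "v i"] y[of "v i"] v by simp_all
  qed
  have T: "dot3 y (v i) = 0" "dot3 x (v i) \<noteq> 0" if "i \<in> T" for i
  proof -
    have "p i \<in> L2 - L1" using on(2) that unfolding T_def by blast
    then show "dot3 y (v i) = 0" "dot3 x (v i) \<noteq> 0" using x[of "v i"] y[of "v i"] v by simp_all
  qed
  have fin: "finite S" "finite T" "card S = n" "card T = n" by (simp_all add: S_def T_def)
  define k where "k i = - (dot3 z (v i) / dot3 y (v i))" for i
  define l where "l i = - (dot3 z (v i) / dot3 x (v i))" for i
  have meetS: "lines_meet_at x (z + k i *s y) (v i)" if "i \<in> S" for i
    unfolding k_def using S[OF that] z by (intro lines_meet_at_shift[OF xy] v) simp_all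
  have meetT: "lines_meet_at y (z + l i *s x) (v i)" if "i \<in> T" for i
    unfolding l_def using T[OF that] z by (intro lines_meet_at_shift[OF yx] v) simp_all
  define A where "A = (\<Prod>i\<in>S. lin (z + k i *s y))"
  define B where "B = (\<Prod>i\<in>T. lin (z + l i *s x))"
  \<comment> \<open>Modulo \<open>y\<close> the form \<open>A\<close> is \<open>z\<^sup>n\<close>, and modulo \<open>x\<close> so is \<open>B\<close>. Hence \<open>b\<close> is \<open>A\<close> on the line
    \<open>x\<close> and \<open>B\<close> on the line \<open>y\<close>.\<close>
  define b where "b = A + B - lin z ^ n"
  have bA: "lin x dvd b - A" and bB: "lin y dvd b - B"
    using prod_lin_shift_dvd[OF fin(2), of x z l] prod_lin_shift_dvd[OF fin(1), of y z k]
    by (simp_all add: b_def A_def B_def fin)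
  have "dot3 (z + k i *s y) (v 0) = 1" "dot3 (z + l i *s x) (v 0) = 1" for i
    using z xy by (simp_all add: dot3_add dot3_scale lines_meet_at_def)
  then have "eval3 b (v 0) = 1"
    by (simp add: b_def A_def B_def eval3_diff eval3_add eval3_prod eval3_power eval3_lin z)
  then have bP: "b \<notin> point_ideal (abs_proj_plane (v 0))" using v(1) by (intro notin_point_ideal) simp_all
  have P: "point_ideal (abs_proj_plane (v 0)) = gen2 (lin x) (lin y)"
    by (rule point_ideal_eq_gen2[OF xy])
  have nd: "\<not> lin x dvd b" "\<not> lin y dvd b"
    using bP unfolding P by (auto elim!: dvdE dest: ring_idealD(4)[OF ring_ideal_gen2] simp: gen2_mem
        ring_idealD(4)[OF ring_ideal_gen2])
  \<comment> \<open>The forms \<open>b\<close> and \<open>x y\<close> vanish at the points of both lines \<open>a\<close>: take \<open>f = b\<close>, \<open>g = x y\<close>.\<close>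
  have mem: "f \<in> point_ideal (p i) \<and> g \<in> point_ideal (p i)"
    if hyps: "lines_meet_at a (w i) (v i)" "i \<in> U" "finite U" "g = lin a * g'"
      "lin a dvd f - (\<Prod>i\<in>U. lin (w i))" for f g g' a w i U
  proof -
    have Pi: "point_ideal (p i) = gen2 (lin a) (lin (w i))"
      using point_ideal_eq_gen2[OF hyps(1)] v(2) by simp
    obtain h where h: "f - (\<Prod>i\<in>U. lin (w i)) = lin a * h" using hyps(5) by (elim dvdE)
    have "(\<Prod>i\<in>U. lin (w i)) = lin (w i) * (\<Prod>i\<in>U - {i}. lin (w i))"
      using hyps(2,3) by (intro prod.remove)
    then have "f = lin a * h + lin (w i) * (\<Prod>i\<in>U - {i}. lin (w i))" using h by (simp add: diff_eq_eq)
    then show ?thesis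
      unfolding Pi hyps(4) using gen2I ring_idealD(4)[OF ring_ideal_gen2 gen2_mem(1)] by blast
  qed
  have ne: "p j \<noteq> p i" if "i \<in> S \<union> T" "j \<in> S \<union> T" "i \<noteq> j" for i j
    using inj that by (auto simp: inj_on_def S_def T_def)
  \<comment> \<open>The points of the line \<open>a\<close>, with \<open>b\<close> in place of the product that cuts them out.\<close>
  have pow: "f \<in> pow2 b (lin a) m"
    if "\<And>i. i \<in> U \<Longrightarrow> f \<in> ideal_power (point_ideal (p i)) m" "finite U" "U \<subseteq> S \<union> T"
      "\<And>i. i \<in> U \<Longrightarrow> lines_meet_at a (w i) (v i)" "lin a dvd b - (\<Prod>i\<in>U. lin (w i))" for f U a w m
  proof -
    have "f \<in> pow2 (lin a) (\<Prod>i\<in>U. lin (w i)) m"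
    proof (rule collinear_Int_powers[where v = v])
      fix i j assume ij: "i \<in> U" "j \<in> U" "i \<noteq> j"
      have "dot3 a (v j) = 0" using that(4)[OF ij(2)] by (simp add: lines_meet_at_def)
      then show "dot3 (w i) (v j) \<noteq> 0"
        using lines_meet_at_unique[OF that(4)[OF ij(1)] v(1)] ne[of i j] ij that(3) v(2) by auto
    qed (use that v(2) in auto)
    then show ?thesis using pow2_cong_mod[OF that(5)] pow2_commute by blast
  qed
  have "point_configuration (p 0) (p ` (S \<union> T)) b (lin x * lin y) 2"
  proof
    show "finite (p ` (S \<union> T))" using fin by simp
    show "(2::nat) \<ge> 1" by simp
    have "b \<in> point_ideal q \<and> lin x * lin y \<in> point_ideal q" if q: "q \<in> p ` (S \<union> T)" for q
    proof -
      obtain i where i: "q = p i" "i \<in> S \<or> i \<in> T" using q by blast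
      from i(2) show ?thesis
      proof
        assume "i \<in> S"
        then show ?thesis
          using mem[of x "\<lambda>i. z + k i *s y" i S, OF meetS] fin bA by (simp add: i(1) A_def)
      next
        assume "i \<in> T"
        then show ?thesis
          using mem[of y "\<lambda>i. z + l i *s x" i T "lin x * lin y" "lin x", OF meetT] fin bB
          by (simp add: i(1) B_def mult.commute)
      qed
    qed
    then show "\<And>q. q \<in> p ` (S \<union> T) \<Longrightarrow> b \<in> point_ideal q"
      and "\<And>q. q \<in> p ` (S \<union> T) \<Longrightarrow> lin x * lin y \<in> point_ideal q" by blast+
  next
    fix m f assume f: "\<And>q. q \<in> p ` (S \<union> T) \<Longrightarrow> f \<in> ideal_power (point_ideal q) m"
    have "f \<in> pow2 b (lin x) m"
      by (rule pow[where U = S and w = "\<lambda>i. z + k i *s y", OF _ _ _ meetS]) (use f fin bA in \<open>auto simp: A_def\<close>)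
    moreover have "f \<in> pow2 b (lin y) m"
      by (rule pow[where U = T and w = "\<lambda>i. z + l i *s x", OF _ _ _ meetT]) (use f fin bB in \<open>auto simp: B_def\<close>)
    moreover have "regular_mod (lin x) (gen2 b (lin y))"
      using regular_mod_point_ideal[OF xy bP] unfolding P
      by (rule regular_mod_gen2_swap[OF lines_meet_at_regular_pair[OF yx]])
    ultimately show "f \<in> pow2 b (lin x * lin y) m"
      using pow2_Int[OF regular_pair_swap[OF lines_meet_at_prime[OF xy] nd(1)]
          regular_pair_swap[OF lines_meet_at_prime[OF yx] nd(2)], of m] by blast
  next
    fix m show "regular_mod b (ideal_power (point_ideal (p 0)) m)"
      using regular_mod_point_ideal_power[OF xy bP] v(2) by simp
  next
    have "lin x \<in> ideal_power (point_ideal (p 0)) 1" "lin y \<in> point_ideal (p 0)"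
      using P v(2) gen2_mem ideal_power_1 by metis+
    then show "lin x * lin y \<in> ideal_power (point_ideal (p 0)) 2"
      using ideal_power_mult[of "lin x" _ 1] by (simp add: numeral_2_eq_2)
  next
    fix m u d assume "lin x * lin y * u - b * d \<in> ideal_power (point_ideal (p 0)) m"
    then obtain d1 where "lin y * u - b * d1 \<in> ideal_power (point_ideal (p 0)) (m - 1)"
      using point_ideal_cancel_line[OF xy bP, of "lin y * u" d m] v(2) by (auto simp: mult.assoc)
    then obtain d2 where "u - b * d2 \<in> ideal_power (point_ideal (p 0)) (m - 1 - 1)"
      using point_ideal_cancel_line[OF yx bP, of u d1 "m - 1"] v(2) by auto
    then show "\<exists>d'. u - b * d' \<in> ideal_power (point_ideal (p 0)) (m - 2)"
      by (auto simp: numeral_2_eq_2)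
  qed
  moreover have "Z = insert (p 0) (p ` (S \<union> T))"
  proof -
    have "{0..2*n} = insert 0 (S \<union> T)" by (auto simp: S_def T_def)
    then show ?thesis by (simp add: Z)
  qed
  ultimately show ?thesis using that by blast
qed

theorem theorem1p6:
  fixes Z :: "'a::field proj_plane set" and I :: "'a poly3 set"
  assumes "finite Z" and "I = ideal_of_points Z"
  shows
    "(\<forall>n\<ge>3. almost_collinear n Z \<longrightarrow>
        (\<forall>t\<ge>1. symbolic_power I (n * t) = ideal_power (symbolic_power I n) t) \<and>
        n = (LEAST e. e \<ge> 1 \<and>
               (\<forall>t\<ge>1. symbolic_power I (e * t) = ideal_power (symbolic_power I e) t))) \<and>
     (\<forall>n. nearly_complete_intersection n Z \<longrightarrow>
        (\<forall>s\<ge>1. \<forall>t\<ge>1.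
           symbolic_power I (2 * s * t) = ideal_power (symbolic_power I (2 * s)) t))"
proof (intro conjI allI impI)
  fix n assume n: "almost_collinear n Z"
  obtain q0 Q b c where Z: "Z = insert q0 Q" and config: "point_configuration q0 Q b c n"
    and proper: "\<And>d. 1 - b * d \<notin> ideal_power (point_ideal q0) 1"
    using almost_collinear_configuration[OF n] by blast
  show "symbolic_power I (n * t) = ideal_power (symbolic_power I n) t" for t
    using point_configuration.symb_power_eq[OF config, of 1] by (simp add: assms(2) Z)
  show "n = (LEAST e. e \<ge> 1 \<and>
      (\<forall>t\<ge>1. symbolic_power I (e * t) = ideal_power (symbolic_power I e) t))"
    using point_configuration.least_exponent[OF config proper] unfolding assms(2) Z .
next
  fix n s t assume "nearly_complete_intersection n Z"
  then obtain q0 Q b c where Z: "Z = insert q0 Q" and config: "point_configuration q0 Q b c 2"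
    by (rule nearly_complete_intersection_configuration)
  show "symbolic_power I (2 * s * t) = ideal_power (symbolic_power I (2 * s)) t"
    using point_configuration.symb_power_eq[OF config] unfolding assms(2) Z .
qed

end
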